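(* Let $t=1/L$, let the FISTA step sizes be $t_{kj}=(t\|B_k\|_2^2)^{-1}$, and suppose the sharpness condition holds: there is $\lambda_s>0$ with $F(x)-F(x_\star)\ge\lambda_s\Delta(x)$ for all $x\in\mathbb{R}^n$. Let $J(\epsilon)$ denote the overall complexity of IPL+FISTA (defined in the context). (a) (Low accuracy) Let $\rho_l>0$ and let the inner FISTA be stopped by the criterion (LACC-FISTA). There exist positive constants $E_1,E_2$, depending only on $\{a_i\}_{i=1}^m,\{b_i\}_{i=1}^m,x_\star,\lambda_s,L$ and $\rho_l$, such that for any $x^0\in\mathbb{R}^n$ with $\Delta(x^0)\le E_1$, $$J(\epsilon)\le E_2/\epsilon,\qquad\forall\epsilon>0.$$ (b) (High accuracy) Let $\rho_h\in(0,1/4)$ and let the inner FISTA be stopped by the criterion (HACC-FISTA). There exist positive constants $E_3,E_4$, depending only on $\{a_i\}_{i=1}^m,\{b_i\}_{i=1}^m,x_\star,\lambda_s,L$ and $\rho_h$, and a sequence of positive numbers $\{\epsilon_i\}_{i=1}^\infty$, depending on $\{\Delta(x^i)\}_{i=1}^\infty$, with $\epsilon_i>\epsilon_{i+1}$ for all $i\ge1$ and $\lim_{i\to\infty}\epsilon_i=0$, such that if $\Delta(x^0)\le E_3$, then $$J(\epsilon_i)\le E_4/\epsilon_i,\qquad\forall i\ge1.$$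
   Context: Let $m,n\ge1$, $a_1,\dots,a_m\in\mathbb{R}^n$, let $A\in\mathbb{R}^{m\times n}$ be the matrix with rows $a_i^\top$, let $x_\star\in\mathbb{R}^n$ be the true signal, and let $b\in\mathbb{R}^m$ with $b_i=(a_i^\top x_\star)^2$ for $i\in\mathbb{I}_1$ and $b_i=\xi_i$ (arbitrary noise) for $i\in\mathbb{I}_2$, where $\mathbb{I}_1,\mathbb{I}_2$ are disjoint with union $\{1,\dots,m\}$. $F(x)=\frac1m\sum_{i=1}^m|(a_i^\top x)^2-b_i|$, $L=\frac2m\|A\|_2^2$ (spectral norm), $\Delta(x)=\min\{\|x-x_\star\|_2,\|x+x_\star\|_2\}$. IPL+FISTA. Given $x^k$, set $B_k=\frac2m\mathrm{diag}(Ax^k)A$, $d_k=\frac1m(b-(Ax^k)^2)$ (entrywise square), $H_k(z)=\frac1{2t}\|z\|_2^2+\|B_kz-d_k\|_1$ for $z\in\mathbb{R}^n$, $D_k(\lambda)=-\frac t2\|B_k^\top\lambda\|_2^2-\lambda^\top d_k$ for $\lambda\in\mathbb{R}^m$, $\|\lambda\|_\infty\le1$, and $z_k(\lambda)=-tB_k^\top\lambda$. The inner FISTA starts at any $\lambda^0\in\mathbb{R}^m$ with $\|\lambda^0\|_\infty\le1$, sets $\lambda_a^0=\lambda_b^0=\lambda_c^0=\lambda^0$, $\gamma_0=1$, and for $j=0,1,2,\dots$ computes $$\lambda_c^{j+1}=(1-\gamma_j)\lambda_a^j+\gamma_j\lambda_b^j,$$ $$\lambda_b^{j+1}=\arg\min_{\|\lambda\|_\infty\le1}\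 \frac{\gamma_j}{2t_{kj}}\|\lambda-\lambda_c^{j+1}\|_2^2+(\lambda-\lambda_c^{j+1})^\top(tB_kB_k^\top\lambda_c^{j+1}+d_k),$$ $$\lambda_a^{j+1}=(1-\gamma_j)\lambda_a^j+\gamma_j\lambda_b^{j+1},\qquad\gamma_{j+1}=2/\left(1+\sqrt{1+4/\gamma_j^2}\right),$$ terminating at the first $j$ at which the chosen criterion holds: (LACC-FISTA) $H_k(z_k(\lambda_a^{j+1}))-D_k(\lambda_a^{j+1})\le\rho_l\left(H_k(0)-H_k(z_k(\lambda_a^{j+1}))\right)$; (HACC-FISTA) $H_k(z_k(\lambda_a^{j+1}))-D_k(\lambda_a^{j+1})\le\frac{\rho_h}{2t}\|z_k(\lambda_a^{j+1})\|_2^2$. On termination, $x^{k+1}=x^k+z_k(\lambda_a^{j+1})$. Let $J_k$ be the number of inner FISTA iterations (i.e. of computations of $\lambda_b^{j+1}$) used to obtain $x^{k+1}$ from $x^k$. The outer loop is terminated after $K_\epsilon$ iterations, where $K_\epsilon$ is the first index with $\Delta(x^{K_\epsilon})\le\epsilon$ (so $\Delta(x^{K_\epsilon-1})>\epsilon$ if $K_\epsilon\ge1$), and $J(\epsilon)=\sum_{k=0}^{K_\epsilon-1}J_k$ (equal to $0$ if $K_\epsilon=0$). *)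

theory Defs
  imports "HOL-Analysis.Analysis"
begin

text \<open>Measurement vectors are the rows \<open>A $ i\<close> of a matrix \<open>A :: real^'n^'m\<close>, with
  \<open>m = CARD('m)\<close> and \<open>n = CARD('n)\<close>.\<close>

abbreviation spectral_norm :: "real^'n^'m \<Rightarrow> real" where
  "spectral_norm M \<equiv> onorm (\<lambda>v. M *v v)"

definition l1_norm :: "real^'m \<Rightarrow> real" where
  "l1_norm v = (\<Sum>i\<in>UNIV. \<bar>v $ i\<bar>)"

definition diag_matrix :: "real^'m \<Rightarrow> real^'m^'m" where
  "diag_matrix v = (\<chi> i j. if i = j then v $ i else 0)"

definition loss :: "real^'n^'m \<Rightarrow> real^'m \<Rightarrow> real^'n \<Rightarrow> real" where
  "loss A b x = (1 / real CARD('m)) * (\<Sum>i\<in>UNIV. \<bar>(A $ i \<bullet> x)\<^sup>2 - b $ i\<bar>)"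

definition lip_const :: "real^'n^'m \<Rightarrow> real" where
  "lip_const A = (2 / real CARD('m)) * (spectral_norm A)\<^sup>2"

definition signal_dist :: "real^'n \<Rightarrow> real^'n \<Rightarrow> real" where
  "signal_dist xs x = min (norm (x - xs)) (norm (x + xs))"


subsection \<open>The subproblem and its dual\<close>

definition sub_matrix :: "real^'n^'m \<Rightarrow> real^'n \<Rightarrow> real^'n^'m" where
  "sub_matrix A x = (2 / real CARD('m)) *\<^sub>R (diag_matrix (A *v x) ** A)"

definition sub_vector :: "real^'n^'m \<Rightarrow> real^'m \<Rightarrow> real^'n \<Rightarrow> real^'m" where
  "sub_vector A b x = (1 / real CARD('m)) *\<^sub>R (b - (\<chi> i. ((A *v x) $ i)\<^sup>2))"

definition primal_obj :: "real^'n^'m \<Rightarrow> real^'m \<Rightarrow> real \<Rightarrow> real^'n \<Rightarrow> real" where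
  "primal_obj B d t z = (1 / (2 * t)) * (norm z)\<^sup>2 + l1_norm (B *v z - d)"

definition dual_obj :: "real^'n^'m \<Rightarrow> real^'m \<Rightarrow> real \<Rightarrow> real^'m \<Rightarrow> real" where
  "dual_obj B d t l = - (t / 2) * (norm (transpose B *v l))\<^sup>2 - l \<bullet> d"

definition primal_point :: "real^'n^'m \<Rightarrow> real \<Rightarrow> real^'m \<Rightarrow> real^'n" where
  "primal_point B t l = - (t *\<^sub>R (transpose B *v l))"


subsection \<open>Inner FISTA loop\<close>

fun fista_gamma :: "nat \<Rightarrow> real" where
  "fista_gamma 0 = 1"
| "fista_gamma (Suc j) = 2 / (1 + sqrt (1 + 4 / (fista_gamma j)\<^sup>2))"

text \<open>\<open>la\<close>, \<open>lb\<close>, \<open>lc\<close> are the three sequences produced by the recursion run without stopping;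
  the stopping rule is applied to them afterwards. The starting point \<open>la 0\<close> is arbitrary
  in the unit box.\<close>

definition fista_iterates ::
  "real^'n^'m \<Rightarrow> real^'m \<Rightarrow> real \<Rightarrow> (nat \<Rightarrow> real)
    \<Rightarrow> (nat \<Rightarrow> real^'m) \<Rightarrow> (nat \<Rightarrow> real^'m) \<Rightarrow> (nat \<Rightarrow> real^'m) \<Rightarrow> bool" where
  "fista_iterates B d t \<tau> la lb lc \<longleftrightarrow>
     infnorm (la 0) \<le> 1 \<and> lb 0 = la 0 \<and> lc 0 = la 0 \<and>
     (\<forall>j. lc (Suc j) = (1 - fista_gamma j) *\<^sub>R la j + fista_gamma j *\<^sub>R lb j \<and>
          is_arg_min
            (\<lambda>l. fista_gamma j / (2 * \<tau> j) * (norm (l - lc (Suc j)))\<^sup>2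
                 + (l - lc (Suc j)) \<bullet> (t *\<^sub>R (B *v (transpose B *v lc (Suc j))) + d))
            (\<lambda>l. infnorm l \<le> 1) (lb (Suc j)) \<and>
          la (Suc j) = (1 - fista_gamma j) *\<^sub>R la j + fista_gamma j *\<^sub>R lb (Suc j))"

definition lacc :: "real \<Rightarrow> real^'n^'m \<Rightarrow> real^'m \<Rightarrow> real \<Rightarrow> real^'m \<Rightarrow> bool" where
  "lacc \<rho> B d t l \<longleftrightarrow>
     primal_obj B d t (primal_point B t l) - dual_obj B d t l
       \<le> \<rho> * (primal_obj B d t 0 - primal_obj B d t (primal_point B t l))"

definition hacc :: "real \<Rightarrow> real^'n^'m \<Rightarrow> real^'m \<Rightarrow> real \<Rightarrow> real^'m \<Rightarrow> bool" where
  "hacc \<rho> B d t l \<longleftrightarrow>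
     primal_obj B d t (primal_point B t l) - dual_obj B d t l
       \<le> \<rho> / (2 * t) * (norm (primal_point B t l))\<^sup>2"


subsection \<open>Outer loop and complexity\<close>

type_synonym ('n, 'm) criterion = "real^'n^'m \<Rightarrow> real^'m \<Rightarrow> real \<Rightarrow> real^'m \<Rightarrow> bool"

definition stops_at ::
  "real^'n^'m \<Rightarrow> real^'m \<Rightarrow> real \<Rightarrow> ('n, 'm) criterion \<Rightarrow> real^'n \<Rightarrow> (nat \<Rightarrow> real^'m)
    \<Rightarrow> nat \<Rightarrow> bool" where
  "stops_at A b t crit x la j \<longleftrightarrow> crit (sub_matrix A x) (sub_vector A b x) t (la (Suc j))"

text \<open>If the inner loop at \<open>x k\<close> never stops, \<open>x (Suc k)\<close> is not produced by the algorithm. Such a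
  run is continued by \<open>x (Suc k) = x k\<close>, so that sequences stay total, but the count below
  charges it infinitely many inner iterations.\<close>

definition ipl_fista_run ::
  "real^'n^'m \<Rightarrow> real^'m \<Rightarrow> real \<Rightarrow> (nat \<Rightarrow> nat \<Rightarrow> real) \<Rightarrow> ('n, 'm) criterion
    \<Rightarrow> (nat \<Rightarrow> real^'n)
    \<Rightarrow> (nat \<Rightarrow> nat \<Rightarrow> real^'m) \<Rightarrow> (nat \<Rightarrow> nat \<Rightarrow> real^'m) \<Rightarrow> (nat \<Rightarrow> nat \<Rightarrow> real^'m) \<Rightarrow> bool" where
  "ipl_fista_run A b t \<tau> crit x la lb lc \<longleftrightarrow>
     (\<forall>k. fista_iterates (sub_matrix A (x k)) (sub_vector A b (x k)) t (\<tau> k) (la k) (lb k) (lc k) \<and>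
          x (Suc k) =
            (if \<exists>j. stops_at A b t crit (x k) (la k) j
             then x k + primal_point (sub_matrix A (x k)) t
                          (la k (Suc (LEAST j. stops_at A b t crit (x k) (la k) j)))
             else x k))"

definition inner_count ::
  "real^'n^'m \<Rightarrow> real^'m \<Rightarrow> real \<Rightarrow> ('n, 'm) criterion \<Rightarrow> real^'n \<Rightarrow> (nat \<Rightarrow> real^'m)
    \<Rightarrow> enat" where
  "inner_count A b t crit x la =
     (if \<exists>j. stops_at A b t crit x la j
      then enat (Suc (LEAST j. stops_at A b t crit x la j)) else \<infinity>)"

text \<open>The complexity is infinite if accuracy \<open>\<epsilon>\<close> is never reached, so a real upper bound on it
  includes termination of the outer loop and of all inner loops before it.\<close>

definition overall_complexity ::
  "real^'n^'m \<Rightarrow> real^'m \<Rightarrow> real^'n \<Rightarrow> real \<Rightarrow> ('n, 'm) criterion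
    \<Rightarrow> (nat \<Rightarrow> real^'n) \<Rightarrow> (nat \<Rightarrow> nat \<Rightarrow> real^'m) \<Rightarrow> real \<Rightarrow> enat" where
  "overall_complexity A b xs t crit x la \<epsilon> =
     (if \<exists>k. signal_dist xs (x k) \<le> \<epsilon>
      then (\<Sum>k < (LEAST k. signal_dist xs (x k) \<le> \<epsilon>). inner_count A b t crit (x k) (la k))
      else \<infinity>)"

end

theory Submission
  imports Defs
begin

text \<open>The duality gap of the dual iterates is the Frank--Wolfe gap over the unit box. Each inner step
  is an inexact Frank--Wolfe step with weight \<open>fista_gamma j\<close>, so among the iterates with index in
  \<open>{n..<2*n}\<close> one has a gap of order \<open>1/n\<close>. By sharpness the criterion (LACC) is met as soon as the
  gap is below a multiple of \<open>\<Delta>\<close>, and (HACC) as soon as it is below a multiple of \<open>\<Delta>\<^sup>2\<close>; the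
  inner loops therefore cost \<open>O(1/\<Delta>)\<close> and \<open>O(1/\<Delta>\<^sup>2)\<close>. The outer loop contracts \<open>F - F(x\<^sub>\<star>)\<close>
  linearly under (LACC), and \<open>\<Delta>\<close> converges quadratically under (HACC). In both cases the cost is
  a geometric sum dominated by its last term, and under (HACC) quadratic convergence turns
  \<open>1/\<Delta>(x\<^sup>i\<^sup>-\<^sup>1)\<^sup>2\<close> into a multiple of \<open>1/\<Delta>(x\<^sup>i)\<close>.\<close>

declare transpose_matrix_vector [simp del]

section \<open>The unit box, the l1 norm and the spectral norm\<close>

lemma infnorm_le_1_iff: "infnorm l \<le> 1 \<longleftrightarrow> (\<forall>i. \<bar>l $ i\<bar> \<le> 1)" for l :: "real^'m"
proof
  assume "infnorm l \<le> 1"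
  then show "\<forall>i. \<bar>l $ i\<bar> \<le> 1"
    using component_le_infnorm_cart order_trans by blast
next
  assume *: "\<forall>i. \<bar>l $ i\<bar> \<le> 1"
  show "infnorm l \<le> 1"
    unfolding infnorm_cart by (rule cSup_least) (use * in auto)
qed

lemma infnorm_convex_comb:
  fixes u v :: "real^'m"
  assumes "infnorm u \<le> 1" "infnorm v \<le> 1" "0 \<le> g" "g \<le> 1"
  shows "infnorm ((1 - g) *\<^sub>R u + g *\<^sub>R v) \<le> 1"
proof -
  have "infnorm ((1 - g) *\<^sub>R u + g *\<^sub>R v) \<le> (1 - g) * infnorm u + g * infnorm v"
    using infnorm_triangle[of "(1 - g) *\<^sub>R u" "g *\<^sub>R v"] assms by (simp add: infnorm_mul)
  also have "\<dots> \<le> (1 - g) * 1 + g * 1"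
    using assms by (intro add_mono mult_left_mono) auto
  finally show ?thesis by simp
qed

lemma norm_diff_unit_box:
  fixes u v :: "real^'m"
  assumes "infnorm u \<le> 1" "infnorm v \<le> 1"
  shows "norm (u - v) \<le> 2 * sqrt (real CARD('m))"
proof -
  have "norm w \<le> sqrt (real CARD('m))" if "infnorm w \<le> 1" for w :: "real^'m"
    using order_trans[OF norm_le_infnorm[of w] mult_left_mono[OF that]] by simp
  from this[OF assms(1)] this[OF assms(2)] show ?thesis
    using norm_triangle_ineq4[of u v] by linarith
qed

lemma l1_norm_triangle: "l1_norm u \<le> l1_norm v + l1_norm (u - v)"
  unfolding l1_norm_def sum.distrib[symmetric] by (intro sum_mono) auto

lemma inner_le_l1_norm:
  assumes "infnorm l \<le> 1"
  shows "l \<bullet> v \<le> l1_norm v"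
proof -
  have "l $ i * v $ i \<le> \<bar>v $ i\<bar>" for i
  proof -
    have "\<bar>l $ i\<bar> * \<bar>v $ i\<bar> \<le> 1 * \<bar>v $ i\<bar>"
      using assms by (intro mult_right_mono) (auto simp: infnorm_le_1_iff)
    then show ?thesis using abs_ge_self[of "l $ i * v $ i"] by (simp add: abs_mult)
  qed
  then show ?thesis
    by (simp add: inner_vec_def l1_norm_def sum_mono)
qed

text \<open>The sign vector is a maximizer, so \<open>l1_norm\<close> is the support function of the
  box. It serves as the Frank--Wolfe vertex in \<open>fista_dual_ascent\<close>.\<close>

lemma l1_norm_attained: "\<exists>l. infnorm l \<le> 1 \<and> l \<bullet> v = l1_norm v" for v :: "real^'m"
proof (intro exI conjI)
  show "infnorm (\<chi> i. sgn (v $ i)) \<le> 1"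
    by (auto simp: infnorm_le_1_iff sgn_if)
  show "(\<chi> i. sgn (v $ i)) \<bullet> v = l1_norm v"
    by (auto simp: inner_vec_def l1_norm_def abs_sgn mult.commute intro: sum.cong)
qed

lemma transpose_mult_inner: "(transpose B *v l) \<bullet> z = l \<bullet> (B *v z)" for B :: "real^'n^'m"
  by (simp add: transpose_matrix_vector dot_lmul_matrix)

lemma norm_matrix_vector_le: "norm (B *v z) \<le> spectral_norm B * norm z" for B :: "real^'n^'m"
  by (rule onorm) simp

text \<open>Pairing \<open>transpose B *v l\<close> with itself and moving the transpose across
  leaves one factor \<open>norm (transpose B *v l)\<close> to cancel.\<close>

lemma norm_transpose_vector_le:
  fixes B :: "real^'n^'m"
  shows "norm (transpose B *v l) \<le> spectral_norm B * norm l"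
proof (cases "transpose B *v l = 0")
  case True
  then show ?thesis by (simp add: onorm_pos_le)
next
  case False
  let ?N = "transpose B *v l"
  have "norm ?N * norm ?N = l \<bullet> (B *v ?N)"
    by (simp add: power2_norm_eq_inner[symmetric] power2_eq_square[symmetric]
        transpose_mult_inner[symmetric])
  also have "\<dots> \<le> norm l * norm (B *v ?N)"
    by (rule norm_cauchy_schwarz)
  also have "\<dots> \<le> norm l * (spectral_norm B * norm ?N)"
    by (intro mult_left_mono norm_matrix_vector_le) simp
  finally have "norm ?N * norm ?N \<le> (spectral_norm B * norm l) * norm ?N"
    by (simp add: algebra_simps)
  then show ?thesis using False by (metis mult_right_le_imp_le zero_less_norm_iff)
qed

subsection \<open>Duality\<close>

definition duality_gap :: "real^'n^'m \<Rightarrow> real^'m \<Rightarrow> real \<Rightarrow> real^'m \<Rightarrow> real" where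
  "duality_gap B d t l = primal_obj B d t (primal_point B t l) - dual_obj B d t l"

lemma primal_point_inner:
  "primal_point B t l \<bullet> w = - t * (l \<bullet> (B *v w))"
  by (simp add: primal_point_def transpose_mult_inner)

lemma dual_obj_eq:
  assumes "t > 0"
  shows "dual_obj B d t l = - (1 / (2 * t)) * (norm (primal_point B t l))\<^sup>2 - l \<bullet> d"
  using assms by (simp add: dual_obj_def primal_point_def power_mult_distrib power2_eq_square)

text \<open>Replacing the l1 term by \<open>l \<bullet> (B *v w - d)\<close> gives a quadratic in
  \<open>w\<close> below the primal objective, with minimizer \<open>primal_point B t l\<close> and
  minimum \<open>dual_obj B d t l\<close>. Its quadratic remainder is kept, because
  \<open>hacc_quadratic\<close> derives quadratic convergence from it.\<close>

lemma strong_weak_duality: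
  assumes "t > 0" "infnorm l \<le> 1"
  shows "1 / (2 * t) * (norm (w - primal_point B t l))\<^sup>2 \<le> primal_obj B d t w - dual_obj B d t l"
proof -
  let ?z = "primal_point B t l"
  have "(norm (w - ?z))\<^sup>2 = (norm w)\<^sup>2 + (norm ?z)\<^sup>2 - 2 * (?z \<bullet> w)"
    by (simp add: power2_norm_eq_inner algebra_simps inner_commute)
  then have "1 / (2 * t) * (norm (w - ?z))\<^sup>2
      = 1 / (2 * t) * (norm w)\<^sup>2 + 1 / (2 * t) * (norm ?z)\<^sup>2 + l \<bullet> (B *v w)"
    using assms(1) by (simp add: primal_point_inner field_simps)
  moreover have "l \<bullet> (B *v w) - l \<bullet> d \<le> l1_norm (B *v w - d)"
    using inner_le_l1_norm[OF assms(2), of "B *v w - d"] by (simp add: inner_diff_right)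
  ultimately show ?thesis
    by (simp add: primal_obj_def dual_obj_eq[OF assms(1)])
qed

lemma weak_duality:
  assumes "t > 0" "infnorm l \<le> 1"
  shows "dual_obj B d t l \<le> primal_obj B d t w"
proof -
  have "0 \<le> 1 / (2 * t) * (norm (w - primal_point B t l))\<^sup>2" using assms by simp
  with strong_weak_duality[OF assms, of w B d] show ?thesis by linarith
qed

text \<open>The residual \<open>B *v primal_point B t l - d\<close> is the gradient of the dual
  objective at \<open>l\<close>, and its l1 norm is the maximum of its pairing with the box. The
  right side is thus the Frank--Wolfe gap at \<open>l\<close>.\<close>

lemma duality_gap_eq:
  assumes "t > 0"
  shows "duality_gap B d t l
    = l1_norm (B *v primal_point B t l - d) - l \<bullet> (B *v primal_point B t l - d)"
proof -
  let ?z = "primal_point B t l"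
  have "1 / t * (norm ?z)\<^sup>2 = - (l \<bullet> (B *v ?z))"
    using assms by (simp add: power2_norm_eq_inner primal_point_inner)
  then show ?thesis
    using assms
    by (simp add: duality_gap_def primal_obj_def dual_obj_eq inner_diff_right field_simps)
qed

lemma dual_obj_segment:
  fixes B :: "real^'n^'m"
  shows "dual_obj B d t (l + s *\<^sub>R e) =
     dual_obj B d t l - s * (e \<bullet> (t *\<^sub>R (B *v (transpose B *v l)) + d))
       - t / 2 * s\<^sup>2 * (norm (transpose B *v e))\<^sup>2"
proof -
  have "(norm (p + s *\<^sub>R q))\<^sup>2 = (norm p)\<^sup>2 + 2 * s * (q \<bullet> p) + s\<^sup>2 * (norm q)\<^sup>2"
    for p q :: "real^'n"
    unfolding power2_norm_eq_inner
    by (simp add: inner_add_left inner_add_right inner_commute power2_eq_square algebra_simps)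
  from this[of "transpose B *v l" "transpose B *v e"]
  have "(norm (transpose B *v l + s *\<^sub>R (transpose B *v e)))\<^sup>2 =
     (norm (transpose B *v l))\<^sup>2 + 2 * s * (e \<bullet> (B *v (transpose B *v l)))
      + s\<^sup>2 * (norm (transpose B *v e))\<^sup>2"
    by (simp add: transpose_mult_inner)
  then show ?thesis
    by (simp add: dual_obj_def matrix_vector_right_distrib matrix_vector_mult_scaleR
        inner_add_left inner_add_right algebra_simps)
qed

subsection \<open>The inner loop as an inexact Frank--Wolfe method\<close>

lemma fista_gamma_pos: "0 < fista_gamma j"
  by (induction j) (auto intro!: divide_pos_pos add_pos_nonneg)

text \<open>In terms of reciprocals the rule is the classical Nesterov recursion.\<close>

lemma inverse_fista_gamma_Suc:
  "1 / fista_gamma (Suc j) = (1 + sqrt (1 + 4 * (1 / fista_gamma j)\<^sup>2)) / 2"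
  by (simp add: power_divide)

text \<open>Each step raises the reciprocal \<open>T\<close> by at least 1/2 and at most 1, because
  \<open>2 * T \<le> sqrt (1 + 4 * T\<^sup>2) \<le> 1 + 2 * T\<close>.\<close>

lemma fista_gamma_bounds: "1 / (real j + 1) \<le> fista_gamma j" "fista_gamma j \<le> 2 / (real j + 2)"
proof -
  have *: "1 + real j / 2 \<le> 1 / fista_gamma j \<and> 1 / fista_gamma j \<le> 1 + real j"
  proof (induction j)
    case 0
    show ?case by simp
  next
    case (Suc j)
    define T where "T = 1 / fista_gamma j"
    have T: "T > 0" using fista_gamma_pos by (simp add: T_def)
    define S where "S = sqrt (1 + 4 * T\<^sup>2)"
    have "2 * T \<le> S"
      unfolding S_def
      using T by (intro real_le_rsqrt) (simp add: power_mult_distrib)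
    moreover have "S \<le> 1 + 2 * T"
      unfolding S_def
      using T by (intro real_le_lsqrt) (auto simp: power2_eq_square algebra_simps)
    ultimately show ?case
      using Suc unfolding inverse_fista_gamma_Suc T_def[symmetric] S_def[symmetric]
      by (auto simp: field_simps)
  qed
  show "1 / (real j + 1) \<le> fista_gamma j"
    using * fista_gamma_pos[of j] by (simp add: field_simps)
  show "fista_gamma j \<le> 2 / (real j + 2)"
    using * fista_gamma_pos[of j] by (simp add: field_simps)
qed

lemma fista_gamma_le_1: "fista_gamma j \<le> 1"
proof -
  have "2 / (real j + 2) \<le> 1" by simp
  then show ?thesis using fista_gamma_bounds(2)[of j] by linarith
qed

text \<open>Successive reciprocals satisfy \<open>S\<^sup>2 - S = T\<^sup>2\<close>. In this form
  the identity makes error recursions telescope after division by the squared weight.\<close>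

lemma fista_gamma_Suc_eq: "(1 - fista_gamma (Suc j)) / (fista_gamma (Suc j))\<^sup>2 = 1 / (fista_gamma j)\<^sup>2"
proof -
  define T where "T = 1 / fista_gamma j"
  define S where "S = 1 / fista_gamma (Suc j)"
  have "2 * S - 1 = sqrt (1 + 4 * T\<^sup>2)"
    unfolding S_def T_def inverse_fista_gamma_Suc by (simp add: field_simps del: power_divide)
  then have "(2 * S - 1)\<^sup>2 = 1 + 4 * T\<^sup>2"
    by simp
  then have "S\<^sup>2 - S = T\<^sup>2"
    by (simp add: power2_eq_square algebra_simps)
  moreover have "(1 - fista_gamma (Suc j)) / (fista_gamma (Suc j))\<^sup>2 = S\<^sup>2 - S"
    using fista_gamma_pos[of "Suc j"] unfolding S_def
    by (simp add: field_simps power2_eq_square del: fista_gamma.simps)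
  ultimately show ?thesis by (simp add: T_def power_divide)
qed

text \<open>Here \<open>h\<close> is a suboptimality and \<open>g\<close> the gap above it.
  Telescoping gives \<open>h n \<le> 4 * C / n\<close>. If all gaps in the window were larger than
  claimed, each of its \<open>n\<close> steps would lower \<open>h\<close> by more than
  \<open>4 * C / n\<^sup>2\<close>, making \<open>h (2 * n)\<close> negative.\<close>

lemma fista_small_gap:
  fixes h g :: "nat \<Rightarrow> real"
  assumes h0: "\<And>j. 0 \<le> h j" and hg: "\<And>j. h j \<le> g j"
    and rec: "\<And>j. h (Suc j) \<le> h j - fista_gamma j * g j + C * (fista_gamma j)\<^sup>2"
    and C: "0 \<le> C" and n: "n \<ge> 1"
  shows "\<exists>j\<in>{n..<2*n}. g j \<le> 16 * C / real n"
proof (rule ccontr)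
  assume "\<not> ?thesis"
  then have big: "16 * C / real n < g j" if "j \<in> {n..<2*n}" for j
    using that by force
  let ?\<gamma> = fista_gamma
  have rec': "h (Suc j) \<le> (1 - ?\<gamma> j) * h j + C * (?\<gamma> j)\<^sup>2" for j
    using rec[of j] mult_left_mono[OF hg[of j] less_imp_le[OF fista_gamma_pos[of j]]]
    by (simp add: algebra_simps)
  \<comment> \<open>After division by the squared weight every step adds just \<open>C\<close>. The
    base case forgets \<open>h 0\<close> because the first weight is 1.\<close>
  have tele: "h (Suc j) / (?\<gamma> j)\<^sup>2 \<le> real (Suc j) * C" for j
  proof (induction j)
    case 0
    show ?case using rec'[of 0] by simp
  next
    case (Suc j)
    have p: "(?\<gamma> (Suc j))\<^sup>2 > 0" using fista_gamma_pos[of "Suc j"] by (simp del: fista_gamma.simps)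
    have "h (Suc (Suc j)) / (?\<gamma> (Suc j))\<^sup>2
        \<le> ((1 - ?\<gamma> (Suc j)) * h (Suc j) + C * (?\<gamma> (Suc j))\<^sup>2) / (?\<gamma> (Suc j))\<^sup>2"
      using rec'[of "Suc j"] p by (intro divide_right_mono) auto
    also have "\<dots> = ((1 - ?\<gamma> (Suc j)) / (?\<gamma> (Suc j))\<^sup>2) * h (Suc j) + C"
      using p by (simp add: add_divide_distrib del: fista_gamma.simps)
    also have "\<dots> = h (Suc j) / (?\<gamma> j)\<^sup>2 + C"
      by (simp only: fista_gamma_Suc_eq) simp
    finally show ?case using Suc by (simp add: algebra_simps)
  qed
  have hn: "h n \<le> 4 * C / real n"
  proof -
    obtain k where k: "n = Suc k" using n by (cases n) auto
    have g2: "(?\<gamma> k)\<^sup>2 \<le> (2 / (real k + 2))\<^sup>2"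
      using fista_gamma_bounds(2)[of k] fista_gamma_pos[of k] by (intro power_mono) auto
    have "h n \<le> real n * C * (?\<gamma> k)\<^sup>2"
      using tele[of k] fista_gamma_pos[of k] k by (simp add: field_simps)
    also have "\<dots> \<le> real n * C * (2 / (real k + 2))\<^sup>2"
      using g2 C by (intro mult_left_mono) auto
    also have "\<dots> \<le> real n * C * (2 / real n)\<^sup>2"
      using C n k by (intro mult_left_mono power_mono divide_left_mono) auto
    also have "\<dots> = 4 * C / real n"
      using n by (simp add: power2_eq_square)
    finally show ?thesis .
  qed
  let ?G = "16 * C / real n"
  \<comment> \<open>In the window the weight lies between \<open>1 / (2 * n)\<close> and
    \<open>2 / n\<close>: a gap above \<open>?G\<close> gains more than
    \<open>8 * C / n\<^sup>2\<close>, and the error costs at most half of that.\<close>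
  have step: "h (Suc j) < h j - ?G / (2 * real n) + 4 * C / (real n)\<^sup>2" if j: "j \<in> {n..<2*n}" for j
  proof -
    have lo: "1 / (2 * real n) \<le> ?\<gamma> j"
    proof -
      have "1 / (2 * real n) \<le> 1 / (real j + 1)"
        using j n by (intro divide_left_mono) auto
      then show ?thesis using fista_gamma_bounds(1)[of j] by linarith
    qed
    have up: "?\<gamma> j \<le> 2 / real n"
    proof -
      have "2 / (real j + 2) \<le> 2 / real n" using j n by (intro divide_left_mono) auto
      then show ?thesis using fista_gamma_bounds(2)[of j] by linarith
    qed
    have "(?\<gamma> j)\<^sup>2 \<le> (2 / real n)\<^sup>2"
      using up fista_gamma_pos[of j] by (intro power_mono) auto
    then have "C * (?\<gamma> j)\<^sup>2 \<le> 4 * C / (real n)\<^sup>2"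
      using mult_left_mono[OF _ C, of "(?\<gamma> j)\<^sup>2" "(2 / real n)\<^sup>2"]
      by (simp add: power_divide mult.commute)
    moreover have "?G / (2 * real n) \<le> ?\<gamma> j * ?G"
      using mult_right_mono[OF lo, of ?G] C by simp
    moreover have "?\<gamma> j * ?G < ?\<gamma> j * g j"
      by (rule mult_strict_left_mono[OF big[OF j] fista_gamma_pos])
    ultimately show ?thesis using rec[of j] by linarith
  qed
  define E where "E = ?G / (2 * real n) - 4 * C / (real n)\<^sup>2"
  have stepE: "h (Suc j) < h j - E" if "j \<in> {n..<2*n}" for j
    using step[OF that] by (simp add: E_def)
  have "h (n + i) \<le> h n - real i * E" if "i \<le> n" for i
    using that
  proof (induction i)
    case (Suc i)
    then show ?case using stepE[of "n + i"] by (simp add: algebra_simps)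
  qed simp
  \<comment> \<open>The last step is split off to obtain a strict inequality. The total decrease
    exactly matches the bound on \<open>h n\<close>, so a weak one would give no
    contradiction.\<close>
  moreover obtain n' where n': "n = Suc n'" using n by (cases n) auto
  ultimately have "h (n + n') \<le> h n - real n' * E"
    by simp
  then have "h (n + n) < h n - real n * E"
    using stepE[of "n + n'"] n' by (simp add: algebra_simps)
  also have "\<dots> \<le> 4 * C / real n - (8 * C / real n - 4 * C / real n)"
    using hn n by (simp add: E_def power2_eq_square field_simps)
  finally show False using h0[of "n + n"] by simp
qed

lemma fista_iterates_in_box:
  assumes "fista_iterates B d t \<tau> la lb lc"
  shows "infnorm (la j) \<le> 1" "infnorm (lb j) \<le> 1"
proof -
  have it: "infnorm (la 0) \<le> 1" "lb 0 = la 0"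
    "\<And>j. infnorm (lb (Suc j)) \<le> 1"
    "\<And>j. la (Suc j) = (1 - fista_gamma j) *\<^sub>R la j + fista_gamma j *\<^sub>R lb (Suc j)"
    using assms unfolding fista_iterates_def is_arg_min_def by auto
  show "infnorm (lb j) \<le> 1" using it by (cases j) auto
  show "infnorm (la j) \<le> 1"
  proof (induction j)
    case (Suc j)
    then show ?case
      unfolding it(4) using it(3) fista_gamma_le_1 less_imp_le[OF fista_gamma_pos]
      by (intro infnorm_convex_comb)
  qed (rule it(1))
qed

text \<open>The proximal term of the inner problem is centred at \<open>lc\<close> instead of \<open>lb\<close>, which invalidates
  the accelerated rate. Its minimizer still solves the linear minimization problem over the box up
  to an error proportional to \<open>fista_gamma j\<close>, so the step is an inexact Frank--Wolfe step.\<close>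

lemma fista_dual_ascent:
  fixes B :: "real^'n^'m"
  assumes it: "fista_iterates B d t \<tau> la lb lc" and t: "t > 0"
    and \<tau>: "\<And>j. \<tau> j = 1 / (t * (spectral_norm B)\<^sup>2)"
  shows "dual_obj B d t (la j) + fista_gamma j * duality_gap B d t (la j)
      - 8 * real CARD('m) * t * (spectral_norm B)\<^sup>2 * (fista_gamma j)\<^sup>2
    \<le> dual_obj B d t (la (Suc j))"
proof -
  define g where "g = fista_gamma j"
  define \<nu> where "\<nu> = spectral_norm B"
  \<comment> \<open>The Euclidean diameter of the box.\<close>
  define R where "R = 2 * sqrt (real CARD('m))"
  have R2: "R\<^sup>2 = 4 * real CARD('m)" by (simp add: R_def power_mult_distrib)
  have R0: "R \<ge> 0" by (simp add: R_def)
  have \<nu>0: "\<nu> \<ge> 0" by (simp add: \<nu>_def onorm_pos_le)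
  have g: "0 < g" "g \<le> 1" using fista_gamma_pos fista_gamma_le_1 by (auto simp: g_def)
  define x where "x = la j"
  define z where "z = lb j"
  define y where "y = lc (Suc j)"
  define z' where "z' = lb (Suc j)"
  let ?N = "\<lambda>v. transpose B *v v"
  define grad where "grad = (\<lambda>p. t *\<^sub>R (B *v (?N p)) + d)"
  have box: "infnorm x \<le> 1" "infnorm z \<le> 1" "infnorm z' \<le> 1"
    using fista_iterates_in_box[OF it] by (auto simp: x_def z_def z'_def)
  have y: "y = (1 - g) *\<^sub>R x + g *\<^sub>R z"
    and am: "is_arg_min (\<lambda>l. g / (2 * \<tau> j) * (norm (l - y))\<^sup>2 + (l - y) \<bullet> grad y)
            (\<lambda>l. infnorm l \<le> 1) z'"
    and x': "la (Suc j) = x + g *\<^sub>R (z' - x)"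
    using it unfolding fista_iterates_def g_def x_def y_def z_def z'_def grad_def
    by (auto simp: algebra_simps)
  have ybox: "infnorm y \<le> 1" unfolding y using box g by (intro infnorm_convex_comb) auto
  \<comment> \<open>This also covers \<open>\<nu> = 0\<close>: then \<open>\<tau> j\<close> is 0 and
    both sides vanish by the convention for division by zero.\<close>
  have coef: "g / (2 * \<tau> j) = g * t * \<nu>\<^sup>2 / 2"
    unfolding \<tau> \<nu>_def by simp
  let ?r = "B *v primal_point B t x - d"
  have gx: "grad x = - ?r"
    by (simp add: grad_def primal_point_def matrix_vector_mult_scaleR vec.neg)
  \<comment> \<open>\<open>\<mu>\<close> minimizes the linear form \<open>grad x\<close> over the
    box, so it is the exact Frank--Wolfe vertex at \<open>x\<close>.\<close>
  obtain \<mu> where \<mu>: "infnorm \<mu> \<le> 1" "\<mu> \<bullet> ?r = l1_norm ?r"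
    using l1_norm_attained by blast
  \<comment> \<open>Compare the proximal values of \<open>z'\<close> and \<open>\<mu>\<close>, drop
    the square of \<open>z'\<close> and bound that of \<open>\<mu>\<close> by the diameter.\<close>
  have lin: "(z' - \<mu>) \<bullet> grad y \<le> g * t * \<nu>\<^sup>2 / 2 * R\<^sup>2"
  proof -
    have "g * t * \<nu>\<^sup>2 / 2 * (norm (z' - y))\<^sup>2 + (z' - y) \<bullet> grad y
        \<le> g * t * \<nu>\<^sup>2 / 2 * (norm (\<mu> - y))\<^sup>2 + (\<mu> - y) \<bullet> grad y"
      using am \<mu>(1) unfolding is_arg_min_linorder coef by blast
    moreover have "0 \<le> g * t * \<nu>\<^sup>2 / 2 * (norm (z' - y))\<^sup>2" using g t by simp
    moreover have "g * t * \<nu>\<^sup>2 / 2 * (norm (\<mu> - y))\<^sup>2 \<le> g * t * \<nu>\<^sup>2 / 2 * R\<^sup>2"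
      using g t norm_diff_unit_box[OF \<mu>(1) ybox] by (intro mult_left_mono power_mono) (auto simp: R_def)
    ultimately show ?thesis by (simp add: inner_diff_left)
  qed
  have Nle: "norm (?N (u - v)) \<le> \<nu> * R" if "infnorm u \<le> 1" "infnorm v \<le> 1" for u v
  proof -
    have "norm (?N (u - v)) \<le> \<nu> * norm (u - v)"
      unfolding \<nu>_def by (rule norm_transpose_vector_le)
    also have "\<dots> \<le> \<nu> * R"
      using norm_diff_unit_box[OF that] \<nu>0 by (intro mult_left_mono) (auto simp: R_def)
    finally show ?thesis .
  qed
  \<comment> \<open>The linear form was taken at \<open>y\<close> instead of \<open>x\<close>. As
    \<open>x - y\<close> is \<open>g\<close> times a difference of box points, this costs only a
    multiple of \<open>g\<close>.\<close>
  have change: "(z' - \<mu>) \<bullet> (grad x - grad y) \<le> g * t * \<nu>\<^sup>2 * R\<^sup>2"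
  proof -
    have "x - y = g *\<^sub>R (x - z)" by (simp add: y algebra_simps)
    then have "grad x - grad y = (t * g) *\<^sub>R (B *v (?N (x - z)))"
      unfolding grad_def
      by (metis (no_types, lifting) add_diff_cancel_right matrix_vector_mult_diff_distrib
          matrix_vector_mult_scaleR scaleR_right_diff_distrib scaleR_scaleR)
    then have "(z' - \<mu>) \<bullet> (grad x - grad y) = t * g * (?N (z' - \<mu>) \<bullet> ?N (x - z))"
      by (simp add: transpose_mult_inner)
    also have "\<dots> \<le> t * g * ((\<nu> * R) * (\<nu> * R))"
    proof (rule mult_left_mono)
      have "?N (z' - \<mu>) \<bullet> ?N (x - z) \<le> norm (?N (z' - \<mu>)) * norm (?N (x - z))"
        by (rule norm_cauchy_schwarz)
      also have "\<dots> \<le> (\<nu> * R) * (\<nu> * R)"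
        using Nle[OF box(3) \<mu>(1)] Nle[OF box(1,2)] \<nu>0 R0 by (intro mult_mono) auto
      finally show "?N (z' - \<mu>) \<bullet> ?N (x - z) \<le> (\<nu> * R) * (\<nu> * R)" .
    qed (use g t in auto)
    finally show ?thesis by (simp add: power2_eq_square algebra_simps)
  qed
  have "(\<mu> - x) \<bullet> grad x = - duality_gap B d t x"
    unfolding gx duality_gap_eq[OF t] using \<mu>(2) by (simp add: inner_diff_left del: minus_diff_eq)
  then have "(z' - x) \<bullet> grad x \<le> - duality_gap B d t x + 3 / 2 * (g * t * \<nu>\<^sup>2 * R\<^sup>2)"
    using lin change by (simp add: inner_diff_left inner_diff_right)
  then have "g * ((z' - x) \<bullet> grad x) \<le> g * (- duality_gap B d t x + 3 / 2 * (g * t * \<nu>\<^sup>2 * R\<^sup>2))"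
    using g by (intro mult_left_mono) auto
  moreover have "t / 2 * g\<^sup>2 * (norm (?N (z' - x)))\<^sup>2 \<le> t / 2 * g\<^sup>2 * (\<nu> * R)\<^sup>2"
    using t Nle[OF box(3,1)] by (intro mult_left_mono power_mono) auto
  \<comment> \<open>The errors 1/2 from \<open>lin\<close>, 1 from \<open>change\<close> and 1/2
    from the curvature add up to 2; with \<open>R2\<close> this becomes the constant 8.\<close>
  ultimately have "dual_obj B d t (x + g *\<^sub>R (z' - x))
      \<ge> dual_obj B d t x + g * duality_gap B d t x - 2 * (t * \<nu>\<^sup>2 * R\<^sup>2 * g\<^sup>2)"
    unfolding dual_obj_segment grad_def[symmetric]
    by (simp add: grad_def power2_eq_square algebra_simps)
  then show ?thesis
    unfolding x' unfolding R2 by (simp add: x_def g_def \<nu>_def algebra_simps)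
qed

text \<open>Apply \<open>fista_small_gap\<close> to the distance from the dual supremum. By weak
  duality every primal value bounds this supremum, which makes it finite and puts the distance below
  the gap. Allowing any larger \<open>C\<close> lets one constant serve all outer iterates.\<close>

lemma fista_gap_bound:
  fixes B :: "real^'n^'m"
  assumes it: "fista_iterates B d t \<tau> la lb lc" and t: "t > 0"
    and \<tau>: "\<And>j. \<tau> j = 1 / (t * (spectral_norm B)\<^sup>2)" and n: "n \<ge> 1"
    and C: "8 * real CARD('m) * t * (spectral_norm B)\<^sup>2 \<le> C"
  shows "\<exists>j\<in>{n..<2*n}. duality_gap B d t (la j) \<le> 16 * C / real n"
proof (rule fista_small_gap[OF _ _ _ _ n])
  let ?D = "dual_obj B d t"
  define S where "S = (SUP l\<in>{l. infnorm l \<le> 1}. ?D l)"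
  have bdd: "bdd_above (?D ` {l. infnorm l \<le> 1})"
    using weak_duality[OF t] by (intro bdd_aboveI2) auto
  note box = fista_iterates_in_box(1)[OF it]
  have ne: "{l :: real^'m. infnorm l \<le> 1} \<noteq> {}"
    using box by blast
  show "0 \<le> S - ?D (la j)" for j
    unfolding S_def using cSUP_upper[OF _ bdd] box by simp
  show "S - ?D (la j) \<le> duality_gap B d t (la j)" for j
    unfolding duality_gap_def S_def
    using cSUP_least[OF ne, of ?D "primal_obj B d t (primal_point B t (la j))"]
      weak_duality[OF t, of _ B d]
    by simp
  show "S - ?D (la (Suc j)) \<le> S - ?D (la j) - fista_gamma j * duality_gap B d t (la j)
      + C * (fista_gamma j)\<^sup>2" for j
    using fista_dual_ascent[OF it t \<tau>, of j] mult_right_mono[OF C, of "(fista_gamma j)\<^sup>2"] by simp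
  have "0 \<le> 8 * real CARD('m) * t * (spectral_norm B)\<^sup>2" using t by simp
  with C show "0 \<le> C" by linarith
qed

text \<open>A stopping rule enters only through a gap threshold \<open>c\<close> that implies it, so
  both criteria are covered.\<close>

lemma inner_count_le:
  fixes A :: "real^'n^'m"
  assumes it: "fista_iterates (sub_matrix A x) (sub_vector A b x) t \<tau> la lb lc" and t: "t > 0"
    and \<tau>: "\<And>j. \<tau> j = 1 / (t * (spectral_norm (sub_matrix A x))\<^sup>2)"
    and C: "8 * real CARD('m) * t * (spectral_norm (sub_matrix A x))\<^sup>2 \<le> C"
    and c: "c > 0"
    and crit: "\<And>l. infnorm l \<le> 1 \<Longrightarrow> duality_gap (sub_matrix A x) (sub_vector A b x) t l \<le> c
      \<Longrightarrow> crit (sub_matrix A x) (sub_vector A b x) t l"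
  shows "\<exists>j. stops_at A b t crit x la j"
    "ereal_of_enat (inner_count A b t crit x la) \<le> ereal (32 * C / c + 2)"
proof -
  have "0 \<le> 8 * real CARD('m) * t * (spectral_norm (sub_matrix A x))\<^sup>2" using t by simp
  with C have C0: "0 \<le> C" by linarith
  \<comment> \<open>Large enough that \<open>16 * C / n \<le> c\<close>; the added 1 also gives
    \<open>n \<ge> 1\<close>.\<close>
  define n where "n = nat \<lfloor>16 * C / c\<rfloor> + 1"
  have n: "n \<ge> 1" "16 * C / c \<le> real n" "real n \<le> 16 * C / c + 1"
    using C0 c unfolding n_def by (auto simp: le_nat_floor) linarith
  obtain j where j: "j \<in> {n..<2*n}"
    "duality_gap (sub_matrix A x) (sub_vector A b x) t (la j) \<le> 16 * C / real n"
    using fista_gap_bound[OF it t \<tau> n(1) C] by blast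
  have "16 * C / real n \<le> c" using n c by (simp add: field_simps)
  with j have "crit (sub_matrix A x) (sub_vector A b x) t (la j)"
    using crit fista_iterates_in_box(1)[OF it] by simp
  \<comment> \<open>The criterion is tested only at \<open>la (Suc i)\<close>;
    \<open>n \<ge> 1\<close> excludes the untested starting point.\<close>
  moreover obtain i where i: "j = Suc i" using j(1) n(1) by (cases j) auto
  ultimately have st: "stops_at A b t crit x la i" by (simp add: stops_at_def)
  then show ex: "\<exists>j. stops_at A b t crit x la j" by blast
  have "(LEAST j. stops_at A b t crit x la j) \<le> i" using st by (rule Least_le)
  then have "real (Suc (LEAST j. stops_at A b t crit x la j)) \<le> real (2 * n)"
    using i j(1) by (subst of_nat_le_iff) simp
  also have "\<dots> \<le> 32 * C / c + 2" using n by simp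
  finally show "ereal_of_enat (inner_count A b t crit x la) \<le> ereal (32 * C / c + 2)"
    unfolding inner_count_def using ex by simp
qed

subsection \<open>The prox-linear model\<close>

lemma norm_matrix_vector_sq: "(norm (A *v z))\<^sup>2 = (\<Sum>i\<in>UNIV. (A $ i \<bullet> z)\<^sup>2)" for A :: "real^'n^'m"
  unfolding power2_norm_eq_inner inner_vec_def[of "A *v z"] matrix_vector_mul_component
  by (simp add: power2_eq_square)

lemma sub_matrix_component:
  fixes A :: "real^'n^'m"
  shows "(sub_matrix A x *v z) $ i = 2 / real CARD('m) * (A $ i \<bullet> x) * (A $ i \<bullet> z)"
proof -
  have "(diag_matrix v *v u) $ i = v $ i * u $ i" for v u :: "real^'m"
    by (simp add: diag_matrix_def matrix_vector_mult_def if_distrib[of "\<lambda>a. a * _"] cong: if_cong)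
  note diag = this
  have "sub_matrix A x *v z = (2 / real CARD('m)) *\<^sub>R (diag_matrix (A *v x) *v (A *v z))"
    by (simp add: sub_matrix_def scaleR_matrix_vector_assoc matrix_vector_mul_assoc)
  then show ?thesis
    by (simp only: vector_scaleR_component diag) (simp add: matrix_vector_mul_component)
qed

lemma linear_model_component:
  fixes A :: "real^'n^'m"
  shows "(sub_matrix A x *v z - sub_vector A b x) $ i
    = 1 / real CARD('m) * (2 * (A $ i \<bullet> x) * (A $ i \<bullet> z) + (A $ i \<bullet> x)\<^sup>2 - b $ i)"
  unfolding vector_minus_component sub_matrix_component
  by (simp add: sub_vector_def matrix_vector_mul_component algebra_simps)

text \<open>Inside the absolute values, the true and the linearized residual differ by exactly
  \<open>(A $ i \<bullet> z)\<^sup>2\<close>, and the sum of these squares is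
  \<open>(norm (A *v z))\<^sup>2\<close>.\<close>

lemma loss_minus_model:
  fixes A :: "real^'n^'m"
  shows "\<bar>loss A b (x + z) - l1_norm (sub_matrix A x *v z - sub_vector A b x)\<bar>
    \<le> lip_const A / 2 * (norm z)\<^sup>2"
proof -
  let ?p = "\<lambda>i. (A $ i \<bullet> (x + z))\<^sup>2 - b $ i"
  let ?q = "\<lambda>i. 2 * (A $ i \<bullet> x) * (A $ i \<bullet> z) + (A $ i \<bullet> x)\<^sup>2 - b $ i"
  have "l1_norm (sub_matrix A x *v z - sub_vector A b x) = 1 / real CARD('m) * (\<Sum>i\<in>UNIV. \<bar>?q i\<bar>)"
    unfolding l1_norm_def linear_model_component
    by (simp add: abs_mult sum_distrib_left del: times_divide_eq_left)
  then have "\<bar>loss A b (x + z) - l1_norm (sub_matrix A x *v z - sub_vector A b x)\<bar>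
      = 1 / real CARD('m) * \<bar>\<Sum>i\<in>UNIV. \<bar>?p i\<bar> - \<bar>?q i\<bar>\<bar>"
    unfolding loss_def by (simp add: sum_subtractf right_diff_distrib[symmetric] abs_mult
        del: times_divide_eq_left)
  also have "\<dots> \<le> 1 / real CARD('m) * (\<Sum>i\<in>UNIV. (A $ i \<bullet> z)\<^sup>2)"
  proof (rule mult_left_mono)
    have "\<bar>\<bar>?p i\<bar> - \<bar>?q i\<bar>\<bar> \<le> (A $ i \<bullet> z)\<^sup>2" for i
    proof -
      have "?p i - ?q i = (A $ i \<bullet> z)\<^sup>2"
        by (simp add: inner_add_right power2_eq_square algebra_simps)
      then show ?thesis
        using abs_triangle_ineq3[of "?p i" "?q i"] by simp
    qed
    then show "\<bar>\<Sum>i\<in>UNIV. \<bar>?p i\<bar> - \<bar>?q i\<bar>\<bar> \<le> (\<Sum>i\<in>UNIV. (A $ i \<bullet> z)\<^sup>2)"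
      by (intro order_trans[OF sum_abs] sum_mono)
  qed simp
  also have "\<dots> \<le> 1 / real CARD('m) * (spectral_norm A * norm z)\<^sup>2"
    unfolding norm_matrix_vector_sq[symmetric]
    by (intro mult_left_mono power_mono norm_matrix_vector_le) auto
  finally show ?thesis
    by (simp add: lip_const_def power_mult_distrib)
qed

text \<open>Cauchy--Schwarz over the rows. The bound controls both the spectral norm of the
  subproblem and the decrease of the model along a step.\<close>

lemma l1_norm_sub_matrix_le:
  fixes A :: "real^'n^'m"
  shows "l1_norm (sub_matrix A x *v z) \<le> lip_const A * norm x * norm z"
proof -
  have "l1_norm (sub_matrix A x *v z)
      = 2 / real CARD('m) * (\<Sum>i\<in>UNIV. \<bar>A $ i \<bullet> x\<bar> * \<bar>A $ i \<bullet> z\<bar>)"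
    unfolding l1_norm_def sub_matrix_component
    by (simp add: abs_mult sum_distrib_left mult.assoc del: times_divide_eq_left)
  also have "\<dots> \<le> 2 / real CARD('m) * (norm (A *v x) * norm (A *v z))"
    unfolding norm_vec_def matrix_mult_dot
    using L2_set_mult_ineq[of "\<lambda>i. A $ i \<bullet> x" "\<lambda>i. A $ i \<bullet> z" UNIV]
    by (intro mult_left_mono) (auto simp: L2_set_def)
  also have "\<dots> \<le> 2 / real CARD('m) * ((spectral_norm A * norm x) * (spectral_norm A * norm z))"
    by (intro mult_left_mono mult_mono norm_matrix_vector_le) (auto simp: onorm_pos_le)
  finally show ?thesis by (simp add: lip_const_def power2_eq_square algebra_simps)
qed

lemma spectral_norm_sub_matrix_le:
  fixes A :: "real^'n^'m"
  shows "spectral_norm (sub_matrix A x) \<le> lip_const A * norm x"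
proof (rule onorm_le)
  fix z
  have "norm (sub_matrix A x *v z) \<le> l1_norm (sub_matrix A x *v z)"
    unfolding l1_norm_def by (rule norm_le_l1_cart)
  then show "norm (sub_matrix A x *v z) \<le> lip_const A * norm x * norm z"
    using l1_norm_sub_matrix_le[of A x z] by linarith
qed

section \<open>Summing inner costs over the outer loop\<close>

text \<open>The reciprocals grow at least by the factor \<open>1 / q\<close>, so the last one
  dominates: \<open>q / (1 - q) + 1 = 1 / (1 - q)\<close>.\<close>

lemma sum_inverse_le_last:
  fixes f :: "nat \<Rightarrow> real"
  assumes "0 \<le> q" "q < 1" "\<And>k. k \<le> n \<Longrightarrow> 0 < f k" "\<And>k. k < n \<Longrightarrow> f (Suc k) \<le> q * f k"
  shows "(\<Sum>k<Suc n. 1 / f k) \<le> 1 / ((1 - q) * f n)"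
  using assms(3,4)
proof (induction n)
  case 0
  then show ?case using assms(1,2) by (simp add: field_simps)
next
  case (Suc n)
  have p: "0 < f n" "0 < f (Suc n)" using Suc.prems(1) by auto
  have "1 / f n \<le> q / f (Suc n)"
    using p Suc.prems(2)[of n] by (simp add: field_simps)
  then have "1 / (1 - q) * (1 / f n) \<le> 1 / (1 - q) * (q / f (Suc n))"
    using assms(2) by (intro mult_left_mono) auto
  moreover have "(\<Sum>k<Suc n. 1 / f k) \<le> 1 / ((1 - q) * f n)"
    using Suc by simp
  ultimately have "(\<Sum>k<Suc n. 1 / f k) \<le> q / ((1 - q) * f (Suc n))"
    by simp
  then have "(\<Sum>k<Suc (Suc n). 1 / f k) \<le> q / ((1 - q) * f (Suc n)) + 1 / f (Suc n)"
    by simp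
  also have "\<dots> = 1 / ((1 - q) * f (Suc n))"
    using p assms(2) by (simp add: field_simps)
  finally show ?case .
qed

text \<open>Costs are bounded only before the stopping index, where the distance still exceeds
  \<open>\<epsilon>\<close>.\<close>

lemma overall_complexity_le:
  assumes ex: "\<exists>k. signal_dist xs (x k) \<le> \<epsilon>"
    and c: "\<And>k. k < (LEAST k. signal_dist xs (x k) \<le> \<epsilon>)
      \<Longrightarrow> ereal_of_enat (inner_count A b t crit (x k) (la k)) \<le> ereal (c k)"
  shows "ereal_of_enat (overall_complexity A b xs t crit x la \<epsilon>)
    \<le> ereal (\<Sum>k < (LEAST k. signal_dist xs (x k) \<le> \<epsilon>). c k)"
proof -
  have "ereal_of_enat (\<Sum>k<n. inner_count A b t crit (x k) (la k)) \<le> ereal (\<Sum>k<n. c k)"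
    if "\<And>k. k < n \<Longrightarrow> ereal_of_enat (inner_count A b t crit (x k) (la k)) \<le> ereal (c k)" for n
    using that
  proof (induction n)
    case (Suc n)
    then show ?case
      unfolding sum.lessThan_Suc ereal_of_enat_add plus_ereal.simps(1)[symmetric]
      by (intro add_mono) auto
  qed (simp add: zero_ereal_def)
  with ex c show ?thesis by (simp add: overall_complexity_def)
qed

text \<open>The second branch covers runs that hit a solution exactly: their total cost is finite, so any
  sequence that is small compared with its inverse will do.\<close>

definition "acc_seq W s =
  (if (\<forall>k. 0 < s k) \<and> (\<forall>k. s (Suc k) < s k) \<and> s \<longlonglongrightarrow> 0 then s
   else (\<lambda>i. 1 / ((W * (\<Sum>k<(LEAST k. s k = 0). 1 / (s k)\<^sup>2) + 1) * real (Suc i))))"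
  for W :: real and s :: "nat \<Rightarrow> real"

text \<open>Valid for every \<open>s\<close>: the first branch is taken only if \<open>s\<close> has
  these properties, and in the second the scale \<open>T\<close> is at least 1 whatever index
  \<open>LEAST\<close> returns.\<close>

lemma acc_seq_props:
  assumes "W \<ge> 0"
  shows "0 < acc_seq W s i" "acc_seq W s (Suc i) < acc_seq W s i" "acc_seq W s \<longlonglongrightarrow> 0"
proof -
  define T where "T = W * (\<Sum>k<(LEAST k. s k = 0). 1 / (s k)\<^sup>2) + 1"
  have "T > 0" using assms by (auto simp: T_def intro!: add_nonneg_pos mult_nonneg_nonneg sum_nonneg)
  moreover have "(\<lambda>i. 1 / (T * real (Suc i))) \<longlonglongrightarrow> 0"
    using tendsto_mult[OF tendsto_const[of "1 / T"] LIMSEQ_inverse_real_of_nat]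
    by (simp add: field_simps)
  ultimately show "0 < acc_seq W s i" "acc_seq W s (Suc i) < acc_seq W s i" "acc_seq W s \<longlonglongrightarrow> 0"
    unfolding acc_seq_def T_def[symmetric] by (auto simp: frac_less2)
qed

subsection \<open>The outer loop under sharpness\<close>

locale sharp_phase_retrieval =
  fixes A :: "real^'n^'m" and b :: "real^'m" and xs :: "real^'n" and \<sigma> :: real
  assumes \<sigma>_pos: "\<sigma> > 0"
    and sharp: "\<And>x. \<sigma> * signal_dist xs x \<le> loss A b x - loss A b xs"
begin

definition "L = lip_const A"
definition "excess x = loss A b x - loss A b xs"
definition "H x = primal_obj (sub_matrix A x) (sub_vector A b x) (1 / L)"
definition "D x = dual_obj (sub_matrix A x) (sub_vector A b x) (1 / L)"
definition "Z x = primal_point (sub_matrix A x) (1 / L)"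
text \<open>Bounds the spectral norm of \<open>sub_matrix A x\<close> for \<open>x\<close> within
  distance 1 of a solution.\<close>

definition "M = L * (norm xs + 1)"
text \<open>The error constant of \<open>fista_dual_ascent\<close> for \<open>t = 1 / L\<close>,
  with \<open>M\<close> in place of the spectral norm.\<close>

definition "C = 8 * real CARD('m) * (1 / L) * M\<^sup>2"
text \<open>Within this radius the model error \<open>L * s\<^sup>2\<close> is at most half of the
  sharpness gain \<open>\<sigma> * s\<close>; the cap 1 gives access to \<open>M\<close>.\<close>

definition "r = min 1 (\<sigma> / (2 * L))"

lemma signal_dist_nonneg: "0 \<le> signal_dist xs x"
  by (simp add: signal_dist_def)

text \<open>If \<open>A\<close> vanished, the loss would be constant, against sharpness at a point
  whose norm differs from that of both solutions.\<close>

lemma L_pos: "L > 0"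
proof (rule ccontr)
  assume "\<not> L > 0"
  then have "\<not> (spectral_norm A)\<^sup>2 > 0" by (auto simp: L_def lip_const_def zero_less_divide_iff)
  then have "spectral_norm A = 0" by simp
  then have "A *v z = 0" for z
    using norm_matrix_vector_le[of A z] by simp
  then have "A $ i \<bullet> z = 0" for i z
    by (metis matrix_vector_mul_component zero_index)
  then have "loss A b x = loss A b xs" for x by (simp add: loss_def)
  moreover obtain x :: "real^'n" where "norm x = norm xs + 1"
    using vector_choose_size[of "norm xs + 1"] by auto
  then have "0 < signal_dist xs x"
    by (auto simp: signal_dist_def eq_neg_iff_add_eq_0[symmetric])
  ultimately show False using sharp[of x] mult_pos_pos[OF \<sigma>_pos]
    by (metis diff_self linorder_not_le)
qed

lemma M_pos: "M > 0"
  using L_pos by (simp add: M_def add_nonneg_pos)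

lemma C_nonneg: "C \<ge> 0"
  using L_pos by (simp add: C_def)

lemma r_pos: "r > 0"
  using L_pos \<sigma>_pos by (simp add: r_def)

lemma L_mult_le:
  assumes "s \<le> r"
  shows "L * s \<le> \<sigma> / 2"
proof -
  have "s \<le> \<sigma> / (2 * L)" using assms by (simp add: r_def)
  then show ?thesis using L_pos by (simp add: field_simps)
qed

section \<open>Excess, distance and the model near the solutions\<close>

lemma excess_ge: "\<sigma> * signal_dist xs x \<le> excess x"
  using sharp by (simp add: excess_def)

lemma excess_nonneg: "0 \<le> excess x"
  using mult_nonneg_nonneg[OF less_imp_le[OF \<sigma>_pos] signal_dist_nonneg] excess_ge by (rule order_trans)

text \<open>Both signs of the signal have the same loss. Working with the displacement
  \<open>w\<close> spares later proofs the choice of sign.\<close>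

lemma closest_solution:
  obtains w where "norm w = signal_dist xs x" "loss A b (x + w) = loss A b xs"
proof (cases "norm (x - xs) \<le> norm (x + xs)")
  case True
  then show ?thesis using that[of "xs - x"] by (simp add: signal_dist_def norm_minus_commute)
next
  case False
  have "norm (- xs - x) = norm (x + xs)"
    by (metis minus_add_distrib norm_minus_cancel uminus_add_conv_diff add.commute)
  moreover have "loss A b (x + (- xs - x)) = loss A b xs" by (simp add: loss_def)
  ultimately show ?thesis using False that[of "- xs - x"] by (simp add: signal_dist_def)
qed

lemma norm_le_signal_dist: "norm x \<le> norm xs + signal_dist xs x"
  using norm_triangle_ineq2[of x xs] norm_triangle_ineq2[of x "- xs"]
  by (auto simp: signal_dist_def min_def)

lemma L_norm_le_M:
  assumes "signal_dist xs x \<le> 1"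
  shows "L * norm x \<le> M"
  unfolding M_def using norm_le_signal_dist[of x] assms L_pos by (intro mult_left_mono) auto

text \<open>For \<open>t = 1 / L\<close> the proximal term exactly offsets the model error. In the
  reverse bound \<open>H_upper\<close> the two halves add up to \<open>L\<close>.\<close>

lemma H_ge_loss: "loss A b (x + z) \<le> H x z"
  using abs_le_D1[OF loss_minus_model[of A b x z]] by (simp add: H_def primal_obj_def L_def)

lemma H_0: "H x 0 = loss A b x"
  using loss_minus_model[of A b x 0] by (simp add: H_def primal_obj_def)

lemma H_upper: "H x z \<le> loss A b (x + z) + L * (norm z)\<^sup>2"
  using abs_le_D2[OF loss_minus_model[of A b x z]] by (simp add: H_def primal_obj_def L_def)

lemma H_closest:
  obtains w where "norm w = signal_dist xs x" "H x w \<le> loss A b xs + L * (signal_dist xs x)\<^sup>2"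
  using closest_solution[of x] H_upper by metis

text \<open>Read backwards: a substantial decrease of the model forces a long step, which (HACC)
  needs.\<close>

lemma H_decrease_le: "H x 0 - H x z \<le> L * norm x * norm z"
proof -
  let ?B = "sub_matrix A x" and ?d = "sub_vector A b x"
  have "l1_norm (- (?B *v z)) = l1_norm (?B *v z)" by (simp add: l1_norm_def)
  then have "l1_norm (- ?d) \<le> l1_norm (?B *v z - ?d) + l1_norm (?B *v z)"
    using l1_norm_triangle[of "- ?d" "?B *v z - ?d"] by simp
  moreover have "0 \<le> 1 / (2 * (1 / L)) * (norm z)\<^sup>2" using L_pos by simp
  ultimately show ?thesis
    using l1_norm_sub_matrix_le[of A x z] by (simp add: H_def primal_obj_def L_def)
qed

text \<open>The converse of sharpness, from the model decrease along the displacement to the closest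
  solution. It makes excess and distance interchangeable up to constants.\<close>

lemma excess_le:
  assumes "signal_dist xs x \<le> 1"
  shows "excess x \<le> (M + L) * signal_dist xs x"
proof -
  obtain w where w: "norm w = signal_dist xs x"
    "H x w \<le> loss A b xs + L * (signal_dist xs x)\<^sup>2"
    by (rule H_closest)
  have "H x 0 - H x w \<le> L * norm x * norm w" by (rule H_decrease_le)
  also have "\<dots> \<le> M * norm w" using L_norm_le_M[OF assms] by (intro mult_right_mono) auto
  finally have "excess x \<le> M * signal_dist xs x + L * (signal_dist xs x)\<^sup>2"
    using w by (simp add: H_0 excess_def)
  moreover have "L * (signal_dist xs x)\<^sup>2 \<le> L * signal_dist xs x"
    using L_pos signal_dist_nonneg[of x] assms
    by (intro mult_left_mono) (auto simp: power2_eq_square mult_left_le)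
  ultimately show ?thesis by (simp add: algebra_simps)
qed

text \<open>By weak duality the dual value is at most the model value at the closest
  solution.\<close>

lemma H_gap_le:
  assumes "infnorm l \<le> 1" "H x (Z x l) - D x l \<le> c"
  shows "H x (Z x l) \<le> loss A b xs + L * (signal_dist xs x)\<^sup>2 + c"
proof -
  obtain w where "H x w \<le> loss A b xs + L * (signal_dist xs x)\<^sup>2"
    by (rule H_closest)
  moreover have "D x l \<le> H x w"
    unfolding D_def H_def using L_pos assms(1) by (intro weak_duality) auto
  ultimately show ?thesis using assms(2) by linarith
qed

lemma H_decrease_ge:
  assumes "infnorm l \<le> 1" "H x (Z x l) - D x l \<le> c" "signal_dist xs x \<le> r"
  shows "\<sigma> * signal_dist xs x / 2 - c \<le> H x 0 - H x (Z x l)"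
proof -
  have "L * signal_dist xs x * signal_dist xs x \<le> \<sigma> / 2 * signal_dist xs x"
    using L_mult_le[OF assms(3)] signal_dist_nonneg by (rule mult_right_mono)
  then show ?thesis
    using H_gap_le[OF assms(1,2)] sharp[of x] by (simp add: H_0 power2_eq_square)
qed

section \<open>Cost of one inner loop\<close>

lemma duality_gap_sub: "duality_gap (sub_matrix A x) (sub_vector A b x) (1 / L) l = H x (Z x l) - D x l"
  by (simp add: duality_gap_def H_def D_def Z_def)

lemma lacc_sub: "lacc \<rho> (sub_matrix A x) (sub_vector A b x) (1 / L) l
    \<longleftrightarrow> H x (Z x l) - D x l \<le> \<rho> * (H x 0 - H x (Z x l))"
  by (simp add: lacc_def H_def D_def Z_def)

lemma hacc_sub: "hacc \<rho> (sub_matrix A x) (sub_vector A b x) (1 / L) l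
    \<longleftrightarrow> H x (Z x l) - D x l \<le> \<rho> * L / 2 * (norm (Z x l))\<^sup>2"
  by (simp add: hacc_def H_def D_def Z_def)

lemma inner_stops:
  assumes "fista_iterates (sub_matrix A x) (sub_vector A b x) (1 / L) \<tau> la lb lc"
    and "\<And>j. \<tau> j = 1 / (1 / L * (spectral_norm (sub_matrix A x))\<^sup>2)"
    and "signal_dist xs x \<le> 1" "c > 0"
    and "\<And>l. infnorm l \<le> 1 \<Longrightarrow> H x (Z x l) - D x l \<le> c
      \<Longrightarrow> crit (sub_matrix A x) (sub_vector A b x) (1 / L) l"
  shows "\<exists>j. stops_at A b (1 / L) crit x la j"
    "ereal_of_enat (inner_count A b (1 / L) crit x la) \<le> ereal (32 * C / c + 2)"
proof -
  have "spectral_norm (sub_matrix A x) \<le> M"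
    using spectral_norm_sub_matrix_le[of A x] L_norm_le_M[OF assms(3)] by (simp add: L_def)
  then have "8 * real CARD('m) * (1 / L) * (spectral_norm (sub_matrix A x))\<^sup>2 \<le> C"
    unfolding C_def using L_pos by (intro mult_left_mono power_mono) (auto simp: onorm_pos_le)
  note * = inner_count_le[OF assms(1) _ assms(2) this assms(4), of crit]
  show "\<exists>j. stops_at A b (1 / L) crit x la j"
    "ereal_of_enat (inner_count A b (1 / L) crit x la) \<le> ereal (32 * C / c + 2)"
    using * L_pos assms(5) by (simp_all add: duality_gap_sub)
qed

definition "WL \<rho> = 64 * C * (1 + \<rho>) / (\<rho> * \<sigma>) + 2"

lemma lacc_inner_count:
  assumes "fista_iterates (sub_matrix A x) (sub_vector A b x) (1 / L) \<tau> la lb lc"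
    and "\<And>j. \<tau> j = 1 / (1 / L * (spectral_norm (sub_matrix A x))\<^sup>2)"
    and s: "0 < signal_dist xs x" "signal_dist xs x \<le> r" and \<rho>: "\<rho> > 0"
  shows "\<exists>j. stops_at A b (1 / L) (lacc \<rho>) x la j"
    "ereal_of_enat (inner_count A b (1 / L) (lacc \<rho>) x la) \<le> ereal (WL \<rho> / signal_dist xs x)"
proof -
  let ?s = "signal_dist xs x"
  \<comment> \<open>The solution of \<open>c = \<rho> * (\<sigma> * ?s / 2 - c)\<close>: the gap
    equals \<open>\<rho>\<close> times the decrease that it guarantees.\<close>
  define c where "c = \<rho> * \<sigma> * ?s / (2 * (1 + \<rho>))"
  have c: "c > 0" using s \<rho> \<sigma>_pos by (simp add: c_def)
  have s1: "?s \<le> 1" using s by (simp add: r_def)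
  have crit: "lacc \<rho> (sub_matrix A x) (sub_vector A b x) (1 / L) l"
    if "infnorm l \<le> 1" "H x (Z x l) - D x l \<le> c" for l
  proof -
    have "c = \<rho> * (\<sigma> * ?s / 2 - c)" using \<rho> by (simp add: c_def field_simps)
    also have "\<dots> \<le> \<rho> * (H x 0 - H x (Z x l))"
      using H_decrease_ge[OF that s(2)] \<rho> by (intro mult_left_mono) auto
    finally show ?thesis using that by (simp add: lacc_sub)
  qed
  note * = inner_stops[where crit = "lacc \<rho>", OF assms(1,2) s1 c crit]
  show "\<exists>j. stops_at A b (1 / L) (lacc \<rho>) x la j" using *(1) by blast
  have "2 \<le> 2 / ?s" using s s1 by (simp add: field_simps)
  then have "32 * C / c + 2 \<le> WL \<rho> / ?s"
    using s \<rho> \<sigma>_pos by (simp add: c_def WL_def add_divide_distrib algebra_simps)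
  then show "ereal_of_enat (inner_count A b (1 / L) (lacc \<rho>) x la) \<le> ereal (WL \<rho> / ?s)"
    using *(2) order_trans ereal_less_eq(3) by blast
qed

definition "WH \<rho> = 32 * C / min (\<sigma> / 4) (\<rho> * L / 2 * (\<sigma> / (4 * M))\<^sup>2) + 2"

lemma hacc_inner_count:
  assumes "fista_iterates (sub_matrix A x) (sub_vector A b x) (1 / L) \<tau> la lb lc"
    and "\<And>j. \<tau> j = 1 / (1 / L * (spectral_norm (sub_matrix A x))\<^sup>2)"
    and s: "0 < signal_dist xs x" "signal_dist xs x \<le> r" and \<rho>: "\<rho> > 0"
  shows "\<exists>j. stops_at A b (1 / L) (hacc \<rho>) x la j"
    "ereal_of_enat (inner_count A b (1 / L) (hacc \<rho>) x la) \<le> ereal (WH \<rho> / (signal_dist xs x)\<^sup>2)"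
proof -
  let ?s = "signal_dist xs x"
  \<comment> \<open>The first term keeps a decrease of \<open>\<sigma> / 4 * ?s\<close>, hence a
    step of length at least \<open>\<sigma> / (4 * M) * ?s\<close>; the second puts the gap below
    the (HACC) threshold for such a step.\<close>
  define c0 where "c0 = min (\<sigma> / 4) (\<rho> * L / 2 * (\<sigma> / (4 * M))\<^sup>2)"
  have c0: "c0 > 0" using \<rho> \<sigma>_pos L_pos M_pos by (simp add: c0_def)
  have s1: "?s \<le> 1" using s by (simp add: r_def)
  have ss: "?s\<^sup>2 \<le> ?s" using s s1 by (simp add: power2_eq_square)
  have crit: "hacc \<rho> (sub_matrix A x) (sub_vector A b x) (1 / L) l"
    if l: "infnorm l \<le> 1" "H x (Z x l) - D x l \<le> c0 * ?s\<^sup>2" for l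
  proof -
    have "c0 * ?s\<^sup>2 \<le> \<sigma> / 4 * ?s"
      using c0 ss \<sigma>_pos by (intro mult_mono) (auto simp: c0_def)
    then have "\<sigma> / 4 * ?s \<le> H x 0 - H x (Z x l)"
      using H_decrease_ge[OF l s(2)] by simp
    also have "\<dots> \<le> L * norm x * norm (Z x l)" by (rule H_decrease_le)
    also have "\<dots> \<le> M * norm (Z x l)"
      using L_norm_le_M[OF s1] by (intro mult_right_mono) auto
    finally have "\<sigma> / (4 * M) * ?s \<le> norm (Z x l)"
      using M_pos by (simp add: field_simps)
    then have "(\<sigma> / (4 * M) * ?s)\<^sup>2 \<le> (norm (Z x l))\<^sup>2"
      using s \<sigma>_pos M_pos by (intro power_mono) auto
    then have "\<rho> * L / 2 * (\<sigma> / (4 * M) * ?s)\<^sup>2 \<le> \<rho> * L / 2 * (norm (Z x l))\<^sup>2"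
      using \<rho> L_pos by (intro mult_left_mono) auto
    moreover have "c0 * ?s\<^sup>2 \<le> \<rho> * L / 2 * (\<sigma> / (4 * M))\<^sup>2 * ?s\<^sup>2"
      by (intro mult_right_mono) (auto simp: c0_def)
    ultimately show ?thesis
      using l unfolding hacc_sub power_mult_distrib mult.assoc by linarith
  qed
  have c: "c0 * ?s\<^sup>2 > 0" using c0 s by simp
  note * = inner_stops[where crit = "hacc \<rho>", OF assms(1,2) s1 c crit]
  show "\<exists>j. stops_at A b (1 / L) (hacc \<rho>) x la j" using *(1) by blast
  have "2 \<le> 2 / ?s\<^sup>2" using s s1 ss by (simp add: field_simps)
  then have "32 * C / (c0 * ?s\<^sup>2) + 2 \<le> WH \<rho> / ?s\<^sup>2"
    unfolding WH_def c0_def[symmetric] by (simp add: add_divide_distrib)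
  then show "ereal_of_enat (inner_count A b (1 / L) (hacc \<rho>) x la) \<le> ereal (WH \<rho> / ?s\<^sup>2)"
    using *(2) order_trans ereal_less_eq(3) by blast
qed

section \<open>Progress of one outer step\<close>

text \<open>The new model excess is at most \<open>L * ?s\<^sup>2\<close>, itself at most half the
  old excess, plus \<open>\<rho>\<close> times the decrease. Solving for it gives the
  factor.\<close>

lemma lacc_decrease:
  assumes "infnorm l \<le> 1" "lacc \<rho> (sub_matrix A x) (sub_vector A b x) (1 / L) l" "\<rho> > 0"
    and s: "signal_dist xs x \<le> r"
  shows "excess (x + Z x l) \<le> (\<rho> + 1 / 2) / (1 + \<rho>) * excess x"
proof -
  let ?s = "signal_dist xs x"
  have "L * ?s * ?s \<le> \<sigma> / 2 * ?s"
    using L_mult_le[OF s] signal_dist_nonneg by (rule mult_right_mono)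
  also have "\<dots> \<le> excess x / 2" using excess_ge[of x] by simp
  finally have "L * ?s\<^sup>2 \<le> excess x / 2" by (simp add: power2_eq_square)
  moreover have "H x (Z x l) \<le> loss A b xs + L * ?s\<^sup>2 + \<rho> * (H x 0 - H x (Z x l))"
    using H_gap_le[OF assms(1)] assms(2) by (simp add: lacc_sub)
  ultimately have "(1 + \<rho>) * (H x (Z x l) - loss A b xs) \<le> (\<rho> + 1 / 2) * excess x"
    by (simp add: excess_def H_0 algebra_simps)
  moreover have "(1 + \<rho>) * excess (x + Z x l) \<le> (1 + \<rho>) * (H x (Z x l) - loss A b xs)"
    using H_ge_loss[of x "Z x l"] assms(3) by (intro mult_left_mono) (auto simp: excess_def)
  ultimately show ?thesis using assms(3) by (simp add: field_simps)
qed

text \<open>Strong convexity bounds the distance of the step from the ideal displacement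
  \<open>w\<close> by the gap, which (HACC) measures by the step itself. For small
  \<open>\<rho>\<close> that term can be absorbed, so step and gap are controlled by the old
  distance, and sharpness returns to the new one.\<close>

lemma hacc_quadratic:
  assumes "infnorm l \<le> 1" "hacc \<rho> (sub_matrix A x) (sub_vector A b x) (1 / L) l"
    and \<rho>: "0 < \<rho>" "\<rho> < 1 / 4"
  shows "signal_dist xs (x + Z x l) \<le> 5 * L / \<sigma> * (signal_dist xs x)\<^sup>2"
proof -
  let ?s = "signal_dist xs x" and ?z = "Z x l"
  obtain w where w: "norm w = ?s" "H x w \<le> loss A b xs + L * ?s\<^sup>2"
    by (rule H_closest)
  have gap: "H x ?z - D x l \<le> \<rho> * L / 2 * (norm ?z)\<^sup>2"
    using assms(2) by (simp add: hacc_sub)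
  have quarter: "\<rho> * L / 2 * (norm ?z)\<^sup>2 \<le> L / 8 * (norm ?z)\<^sup>2"
    using \<rho> L_pos by (intro mult_right_mono) auto
  have "loss A b xs \<le> H x ?z"
    using H_ge_loss[of x ?z] excess_nonneg[of "x + ?z"] by (simp add: excess_def)
  moreover have "L / 2 * (norm (w - ?z))\<^sup>2 \<le> H x w - D x l"
    using strong_weak_duality[OF _ assms(1), of "1 / L"] L_pos by (simp add: H_def D_def Z_def)
  ultimately have "L / 2 * (norm (w - ?z))\<^sup>2 \<le> L / 2 * (2 * ?s\<^sup>2 + 1 / 4 * (norm ?z)\<^sup>2)"
    using w(2) gap quarter by (simp add: algebra_simps)
  then have "(norm (w - ?z))\<^sup>2 \<le> 2 * ?s\<^sup>2 + 1 / 4 * (norm ?z)\<^sup>2"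
    using L_pos by (simp only: mult_le_cancel_left_pos half_gt_zero)
  \<comment> \<open>The coefficient 1/2 of \<open>norm ?z\<close> is below 1, so the triangle
    inequality can absorb it and yields the factor 5.\<close>
  also have "\<dots> \<le> (3 / 2 * ?s + 1 / 2 * norm ?z)\<^sup>2"
  proof -
    have "0 \<le> ?s * norm ?z" using signal_dist_nonneg by simp
    moreover have "(3 / 2 * ?s + 1 / 2 * norm ?z)\<^sup>2
        = 9 / 4 * ?s\<^sup>2 + 3 / 2 * (?s * norm ?z) + 1 / 4 * (norm ?z)\<^sup>2"
      by (simp add: power2_eq_square algebra_simps)
    ultimately show ?thesis using zero_le_power2[of ?s] by linarith
  qed
  finally have "norm (w - ?z) \<le> 3 / 2 * ?s + 1 / 2 * norm ?z"
    by (rule power2_le_imp_le) (use signal_dist_nonneg[of x] in auto)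
  moreover have "norm ?z \<le> norm w + norm (w - ?z)"
    using norm_triangle_sub[of ?z w] by (simp add: norm_minus_commute)
  ultimately have "norm ?z \<le> 5 * ?s" using w(1) by linarith
  then have "(norm ?z)\<^sup>2 \<le> (5 * ?s)\<^sup>2" by (intro power_mono) auto
  then have "L / 8 * (norm ?z)\<^sup>2 \<le> L / 8 * (25 * ?s\<^sup>2)"
    using L_pos by (intro mult_left_mono) (auto simp: power_mult_distrib)
  also have "\<dots> = 25 / 8 * (L * ?s\<^sup>2)" by simp
  finally have z: "L / 8 * (norm ?z)\<^sup>2 \<le> 25 / 8 * (L * ?s\<^sup>2)" .
  have "excess (x + ?z) \<le> 5 * (L * ?s\<^sup>2)"
    using z H_gap_le[OF assms(1) gap] quarter H_ge_loss[of x ?z]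
      mult_nonneg_nonneg[OF less_imp_le[OF L_pos] zero_le_power2[of ?s]]
    unfolding excess_def by linarith
  then have "\<sigma> * signal_dist xs (x + ?z) \<le> 5 * L * ?s\<^sup>2"
    using excess_ge[of "x + ?z"] by linarith
  then show ?thesis using \<sigma>_pos by (simp add: field_simps)
qed

section \<open>Complexity of a whole run\<close>

text \<open>Isolates the stalled iteration. The inner counts show that inside radius
  \<open>r\<close> it can occur only at distance 0.\<close>

lemma run_step:
  assumes "ipl_fista_run A b (1 / L) \<tau> crit x la lb lc"
  shows "fista_iterates (sub_matrix A (x k)) (sub_vector A b (x k)) (1 / L) (\<tau> k) (la k) (lb k) (lc k)"
    and "(\<not> (\<exists>j. stops_at A b (1 / L) crit (x k) (la k) j) \<and> x (Suc k) = x k) \<or>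
      (\<exists>l. infnorm l \<le> 1 \<and> crit (sub_matrix A (x k)) (sub_vector A b (x k)) (1 / L) l
        \<and> x (Suc k) = x k + Z (x k) l)"
proof -
  show it: "fista_iterates (sub_matrix A (x k)) (sub_vector A b (x k)) (1 / L) (\<tau> k) (la k) (lb k) (lc k)"
    using assms by (auto simp: ipl_fista_run_def)
  have eq: "x (Suc k) =
            (if \<exists>j. stops_at A b (1 / L) crit (x k) (la k) j
             then x k + Z (x k) (la k (Suc (LEAST j. stops_at A b (1 / L) crit (x k) (la k) j)))
             else x k)"
    using assms by (simp add: ipl_fista_run_def Z_def)
  show "(\<not> (\<exists>j. stops_at A b (1 / L) crit (x k) (la k) j) \<and> x (Suc k) = x k) \<or>
      (\<exists>l. infnorm l \<le> 1 \<and> crit (sub_matrix A (x k)) (sub_vector A b (x k)) (1 / L) l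
        \<and> x (Suc k) = x k + Z (x k) l)"
  proof (cases "\<exists>j. stops_at A b (1 / L) crit (x k) (la k) j")
    case True
    let ?j = "LEAST j. stops_at A b (1 / L) crit (x k) (la k) j"
    have "stops_at A b (1 / L) crit (x k) (la k) ?j" using True by (rule LeastI_ex)
    then have "crit (sub_matrix A (x k)) (sub_vector A b (x k)) (1 / L) (la k (Suc ?j))"
      by (simp add: stops_at_def)
    moreover have "x (Suc k) = x k + Z (x k) (la k (Suc ?j))" using eq True by simp
    ultimately show ?thesis using fista_iterates_in_box(1)[OF it, of "Suc ?j"] by blast
  qed (use eq in simp)
qed

lemma lacc_complexity:
  assumes \<rho>: "\<rho> > 0"
    and \<tau>: "\<And>k j. \<tau> k j = 1 / (1 / L * (spectral_norm (sub_matrix A (x k)))\<^sup>2)"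
    and run: "ipl_fista_run A b (1 / L) \<tau> (lacc \<rho>) x la lb lc"
    and init: "signal_dist xs (x 0) \<le> min r (\<sigma> * r / (M + L))"
    and \<epsilon>: "\<epsilon> > 0"
  shows "ereal_of_enat (overall_complexity A b xs (1 / L) (lacc \<rho>) x la \<epsilon>)
    \<le> ereal (2 * WL \<rho> * (M + L) * (1 + \<rho>) / \<sigma> / \<epsilon>)"
proof -
  let ?s = "\<lambda>k. signal_dist xs (x k)" and ?f = "\<lambda>k. excess (x k)"
  define q where "q = (\<rho> + 1 / 2) / (1 + \<rho>)"
  have q: "0 < q" "q < 1" using \<rho> by (auto simp: q_def)
  have G: "M + L > 0" using M_pos L_pos by simp
  have W: "WL \<rho> > 0" using C_nonneg \<rho> \<sigma>_pos by (simp add: WL_def add_nonneg_pos)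
  have cnt: "\<exists>j. stops_at A b (1 / L) (lacc \<rho>) (x k) (la k) j"
    "ereal_of_enat (inner_count A b (1 / L) (lacc \<rho>) (x k) (la k)) \<le> ereal (WL \<rho> / ?s k)"
    if "0 < ?s k" "?s k \<le> r" for k
    using lacc_inner_count[OF run_step(1)[OF run] \<tau> that \<rho>] by blast+
  have step: "?f (Suc k) \<le> q * ?f k" if "?s k \<le> r" for k
    using run_step(2)[OF run, of k]
  proof (elim disjE conjE exE)
    assume "\<not> (\<exists>j. stops_at A b (1 / L) (lacc \<rho>) (x k) (la k) j)" "x (Suc k) = x k"
    moreover from this have "?s k = 0"
      using cnt(1)[OF _ that] signal_dist_nonneg[of "x k"] by (metis less_eq_real_def)
    then have "?f k \<le> 0" using excess_le[of "x k"] by simp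
    ultimately show ?thesis using excess_nonneg[of "x k"] by simp
  next
    fix l assume "infnorm l \<le> 1" "x (Suc k) = x k + Z (x k) l"
      "lacc \<rho> (sub_matrix A (x k)) (sub_vector A b (x k)) (1 / L) l"
    then show ?thesis using lacc_decrease[of l \<rho> "x k"] \<rho> that by (simp add: q_def)
  qed
  have s_le: "?s k \<le> ?f k / \<sigma>" for k
    using excess_ge[of "x k"] \<sigma>_pos by (simp add: field_simps)
  have s_le_r: "?s k \<le> r" if "?f k \<le> q ^ k * (\<sigma> * r)" for k
  proof -
    have "q ^ k * (\<sigma> * r) \<le> 1 * (\<sigma> * r)"
      using q \<sigma>_pos r_pos by (intro mult_right_mono power_le_one) auto
    then have "\<sigma> * ?s k \<le> \<sigma> * r" using that excess_ge[of "x k"] by linarith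
    then show ?thesis using \<sigma>_pos by simp
  qed
  \<comment> \<open>The induction runs on the excess, the quantity known to contract; staying below
    \<open>\<sigma> * r\<close> keeps the distance within \<open>r\<close>.\<close>
  have f_le: "?f k \<le> q ^ k * (\<sigma> * r)" for k
  proof (induction k)
    case 0
    have "?s 0 \<le> r" "?s 0 \<le> \<sigma> * r / (M + L)" using init by auto
    moreover have "?f 0 \<le> (M + L) * ?s 0"
      using excess_le[of "x 0"] \<open>?s 0 \<le> r\<close> by (simp add: r_def)
    ultimately show ?case using G by (simp add: field_simps)
  next
    case (Suc k)
    have "?f (Suc k) \<le> q * ?f k" using step s_le_r[OF Suc] .
    also have "\<dots> \<le> q * (q ^ k * (\<sigma> * r))" using Suc q by (intro mult_left_mono) auto
    finally show ?case by simp
  qed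
  have sr: "?s k \<le> r" for k using s_le_r f_le .
  have ex: "\<exists>k. ?s k \<le> \<epsilon>"
  proof -
    obtain k where k: "q ^ k < \<epsilon> / r"
      using real_arch_pow_inv[of "\<epsilon> / r" q] q \<epsilon> r_pos by auto
    have "?s k \<le> q ^ k * (\<sigma> * r) / \<sigma>"
      using s_le[of k] f_le[of k] \<sigma>_pos by (meson divide_right_mono less_imp_le order_trans)
    also have "\<dots> = q ^ k * r" using \<sigma>_pos by simp
    also have "\<dots> \<le> \<epsilon>" using k r_pos by (simp add: field_simps)
    finally show ?thesis by blast
  qed
  let ?K = "LEAST k. ?s k \<le> \<epsilon>"
  have big: "\<epsilon> < ?s k" if "k < ?K" for k
    using not_less_Least[OF that] by simp
  have "ereal_of_enat (overall_complexity A b xs (1 / L) (lacc \<rho>) x la \<epsilon>)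
      \<le> ereal (\<Sum>k<?K. WL \<rho> / ?s k)"
    using ex by (rule overall_complexity_le) (use big \<epsilon> cnt(2) sr in fastforce)
  also have "\<dots> \<le> ereal (2 * WL \<rho> * (M + L) * (1 + \<rho>) / \<sigma> / \<epsilon>)"
  proof (cases ?K)
    case 0
    have "0 \<le> 2 * WL \<rho> * (M + L) * (1 + \<rho>) / \<sigma> / \<epsilon>" using W G \<rho> \<sigma>_pos \<epsilon> by simp
    then show ?thesis unfolding 0 by simp
  next
    case (Suc n)
    have f_pos: "0 < ?f k" if "k \<le> n" for k
      using big[of k] that Suc \<epsilon> excess_ge[of "x k"] \<sigma>_pos
      by (metis le_imp_less_Suc less_le_trans mult_pos_pos order_less_trans)
    \<comment> \<open>Costs are rewritten in terms of the excess, to which the geometric sum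
      applies.\<close>
    have "WL \<rho> / ?s k \<le> WL \<rho> * (M + L) * (1 / ?f k)" if "k < ?K" for k
    proof -
      have "WL \<rho> * ?f k \<le> WL \<rho> * ((M + L) * ?s k)"
        using excess_le[of "x k"] sr[of k] W by (intro mult_left_mono) (auto simp: r_def)
      moreover have "0 < ?s k" using big[OF that] \<epsilon> by simp
      moreover have "0 < ?f k" using f_pos that Suc by simp
      ultimately show ?thesis by (simp add: field_simps)
    qed
    then have "(\<Sum>k<?K. WL \<rho> / ?s k) \<le> (\<Sum>k<?K. WL \<rho> * (M + L) * (1 / ?f k))"
      by (intro sum_mono) auto
    also have "\<dots> = WL \<rho> * (M + L) * (\<Sum>k<Suc n. 1 / ?f k)"
      unfolding Suc sum_distrib_left ..
    also have "\<dots> \<le> WL \<rho> * (M + L) * (1 / ((1 - q) * ?f n))"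
      using W G q f_pos step[OF sr] by (intro mult_left_mono sum_inverse_le_last) auto
    also have "\<dots> \<le> WL \<rho> * (M + L) * (1 / ((1 - q) * (\<sigma> * \<epsilon>)))"
    proof -
      have "\<sigma> * \<epsilon> \<le> ?f n"
        using mult_strict_left_mono[OF big[of n] \<sigma>_pos] Suc excess_ge[of "x n"] by simp
      then have "(1 - q) * (\<sigma> * \<epsilon>) \<le> (1 - q) * ?f n" using q by (intro mult_left_mono) auto
      then show ?thesis
        using W G q \<sigma>_pos \<epsilon> by (intro mult_left_mono frac_le) auto
    qed
    also have "1 - q = 1 / (2 * (1 + \<rho>))" using \<rho> by (simp add: q_def field_simps)
    also have "WL \<rho> * (M + L) * (1 / (1 / (2 * (1 + \<rho>)) * (\<sigma> * \<epsilon>)))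
        = 2 * WL \<rho> * (M + L) * (1 + \<rho>) / \<sigma> / \<epsilon>"
      using \<rho> \<sigma>_pos \<epsilon> by (simp add: field_simps)
    finally show ?thesis by simp
  qed
  finally show ?thesis .
qed

lemma hacc_complexity:
  assumes \<rho>: "0 < \<rho>" "\<rho> < 1 / 4"
    and \<tau>: "\<And>k j. \<tau> k j = 1 / (1 / L * (spectral_norm (sub_matrix A (x k)))\<^sup>2)"
    and run: "ipl_fista_run A b (1 / L) \<tau> (hacc \<rho>) x la lb lc"
    and init: "signal_dist xs (x 0) \<le> min r (\<sigma> / (10 * L))"
    and i: "i \<ge> 1"
  defines "e \<equiv> acc_seq (WH \<rho>) (\<lambda>k. signal_dist xs (x k))"
  shows "ereal_of_enat (overall_complexity A b xs (1 / L) (hacc \<rho>) x la (e i))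
    \<le> ereal (max 1 (WH \<rho> * (4 / 3) * (5 * L / \<sigma>)) / e i)"
proof -
  let ?s = "\<lambda>k. signal_dist xs (x k)" and ?W = "WH \<rho>"
  define Q where "Q = 5 * L / \<sigma>"
  have Q: "Q > 0" using L_pos \<sigma>_pos by (simp add: Q_def)
  have W: "?W > 0"
    using C_nonneg \<rho> \<sigma>_pos L_pos by (simp add: WH_def add_nonneg_pos)
  have cnt: "\<exists>j. stops_at A b (1 / L) (hacc \<rho>) (x k) (la k) j"
    "ereal_of_enat (inner_count A b (1 / L) (hacc \<rho>) (x k) (la k)) \<le> ereal (?W / (?s k)\<^sup>2)"
    if "0 < ?s k" "?s k \<le> r" for k
    using hacc_inner_count[OF run_step(1)[OF run] \<tau> that \<rho>(1)] by blast+
  have step: "?s (Suc k) \<le> Q * (?s k)\<^sup>2" if "?s k \<le> r" for k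
    using run_step(2)[OF run, of k]
  proof (elim disjE conjE exE)
    assume "\<not> (\<exists>j. stops_at A b (1 / L) (hacc \<rho>) (x k) (la k) j)" "x (Suc k) = x k"
    moreover from this have "?s k = 0"
      using cnt(1)[OF _ that] signal_dist_nonneg[of "x k"] by (metis less_eq_real_def)
    ultimately show ?thesis by simp
  next
    fix l assume "infnorm l \<le> 1" "x (Suc k) = x k + Z (x k) l"
      "hacc \<rho> (sub_matrix A (x k)) (sub_vector A b (x k)) (1 / L) l"
    then show ?thesis using hacc_quadratic[of l \<rho> "x k"] \<rho> by (simp add: Q_def)
  qed
  \<comment> \<open>The radius \<open>\<sigma> / (10 * L)\<close> is where
    \<open>Q * ?s k \<le> 1 / 2\<close>, so quadratic convergence gives halving.\<close>
  have half: "?s (Suc k) \<le> ?s k / 2" if "?s k \<le> r" "?s k \<le> \<sigma> / (10 * L)" for k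
  proof -
    have "Q * ?s k \<le> 1 / 2" using that(2) L_pos \<sigma>_pos by (simp add: Q_def field_simps)
    then have "Q * ?s k * ?s k \<le> 1 / 2 * ?s k"
      using signal_dist_nonneg by (rule mult_right_mono)
    then show ?thesis using step[OF that(1)] by (simp add: power2_eq_square mult.assoc)
  qed
  have bound: "?s k \<le> r \<and> ?s k \<le> \<sigma> / (10 * L)" for k
  proof (induction k)
    case (Suc k)
    then show ?case using half[of k] signal_dist_nonneg[of "x k"] by linarith
  qed (use init in simp)
  then have sr: "?s k \<le> r" and half': "?s (Suc k) \<le> ?s k / 2" for k
    using half by auto
  have e_pos: "0 < e i" unfolding e_def using acc_seq_props(1) W by simp
  let ?K = "LEAST k. ?s k \<le> e i"
  have big: "e i < ?s k" if "k < ?K" for k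
    using not_less_Least[OF that] by simp
  have complexity: "ereal_of_enat (overall_complexity A b xs (1 / L) (hacc \<rho>) x la (e i))
      \<le> ereal (?W * (\<Sum>k<?K. 1 / (?s k)\<^sup>2))" if "\<exists>k. ?s k \<le> e i"
  proof -
    have "ereal_of_enat (overall_complexity A b xs (1 / L) (hacc \<rho>) x la (e i))
        \<le> ereal (\<Sum>k<?K. ?W / (?s k)\<^sup>2)"
      using that by (rule overall_complexity_le) (use big e_pos cnt(2) sr in fastforce)
    then show ?thesis by (simp add: sum_distrib_left)
  qed
  let ?E = "max 1 (?W * (4 / 3) * Q)"
  show ?thesis
  proof (cases "\<forall>k. 0 < ?s k")
    case True
    have dec: "?s (Suc k) < ?s k" for k using half'[of k] True[rule_format, of k] by linarith
    have geo: "?s k \<le> ?s 0 * (1 / 2) ^ k" for k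
    proof (induction k)
      case (Suc k)
      then show ?case using half'[of k] by simp
    qed simp
    have "?s \<longlonglongrightarrow> 0"
    proof (rule tendsto_sandwich[OF _ _ tendsto_const])
      show "(\<lambda>k. ?s 0 * (1 / 2) ^ k) \<longlonglongrightarrow> 0"
        by (intro tendsto_mult_right_zero LIMSEQ_power_zero) simp
    qed (use geo signal_dist_nonneg in auto)
    with True dec have e: "e = ?s" by (simp add: e_def acc_seq_def)
    \<comment> \<open>\<open>i \<ge> 1\<close> provides the preceding iterate \<open>n\<close>,
      whose inner loop is the last one counted.\<close>
    obtain n where n: "i = Suc n" using i by (cases i) auto
    \<comment> \<open>The accuracy is itself the distance at index \<open>i\<close>, which strict
      decrease reaches first at \<open>i\<close>.\<close>
    have "?K = i"
    proof (rule Least_equality)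
      show "?s i \<le> e i" by (simp add: e)
      have "strict_mono (\<lambda>k. - ?s k)" by (rule strict_monoI_Suc) (use dec in simp)
      then have "?s i < ?s k" if "k < i" for k using strict_monoD[of "\<lambda>k. - ?s k", OF _ that] by simp
      then show "i \<le> k" if "?s k \<le> e i" for k using that unfolding e by (meson not_le)
    qed
    then have "ereal_of_enat (overall_complexity A b xs (1 / L) (hacc \<rho>) x la (e i))
        \<le> ereal (?W * (\<Sum>k<Suc n. 1 / (?s k)\<^sup>2))"
      using complexity n by (simp only:) (use e in auto)
    also have "?W * (\<Sum>k<Suc n. 1 / (?s k)\<^sup>2) \<le> ?W * (1 / ((1 - 1 / 4) * (?s n)\<^sup>2))"
    proof (intro mult_left_mono sum_inverse_le_last)
      show "(?s (Suc k))\<^sup>2 \<le> 1 / 4 * (?s k)\<^sup>2" for k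
        using power_mono[OF half'[of k] signal_dist_nonneg, of 2] by (simp add: power_divide)
    qed (use True W in \<open>auto simp: less_imp_neq[symmetric]\<close>)
    also have "\<dots> = ?W * (4 / 3) * (1 / (?s n)\<^sup>2)" by simp
    \<comment> \<open>Quadratic convergence in the last step trades the squared distance at
      \<open>n\<close> for the distance at \<open>i\<close>.\<close>
    also have "\<dots> \<le> ?W * (4 / 3) * (Q / ?s (Suc n))"
    proof (rule mult_left_mono)
      have "0 < ?s n" "0 < ?s (Suc n)" using True by auto
      then show "1 / (?s n)\<^sup>2 \<le> Q / ?s (Suc n)"
        using step[OF sr[of n]] by (simp add: field_simps)
    qed (use W in simp)
    also have "\<dots> = ?W * (4 / 3) * Q / e i" by (simp add: e n)
    also have "\<dots> \<le> ?E / e i" using e_pos by (intro divide_right_mono) auto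
    finally show ?thesis by (simp add: Q_def)
  next
    case False
    then obtain k0 where "?s k0 = 0"
      using signal_dist_nonneg by (metis less_eq_real_def)
    let ?n = "LEAST k. ?s k = 0"
    let ?T = "?W * (\<Sum>k<?n. 1 / (?s k)\<^sup>2)"
    have n: "?s ?n = 0" using \<open>?s k0 = 0\<close> by (rule LeastI)
    have T: "?T \<ge> 0" using W by (intro mult_nonneg_nonneg sum_nonneg) auto
    have e: "e i = 1 / ((?T + 1) * real (Suc i))"
      unfolding e_def acc_seq_def using False by (simp only: simp_thms if_False)
    have small: "?s ?n \<le> e i" using n e_pos by simp
    \<comment> \<open>The run stops no later than at the exact solution, so \<open>?T\<close> bounds
      its total cost, and \<open>e i\<close> was chosen with \<open>1 / e i\<close> above
      \<open>?T\<close>. This branch needs the constant 1 in \<open>?E\<close>.\<close>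
    then have "?K \<le> ?n" by (rule Least_le)
    then have "?W * (\<Sum>k<?K. 1 / (?s k)\<^sup>2) \<le> ?T"
      using W by (intro mult_left_mono sum_mono2) auto
    also have "\<dots> \<le> (?T + 1) * 1" by simp
    also have "\<dots> \<le> (?T + 1) * real (Suc i)" using T by (intro mult_left_mono) auto
    also have "\<dots> = 1 / e i" by (simp add: e)
    also have "\<dots> \<le> ?E / e i" using e_pos by (intro divide_right_mono) auto
    finally show ?thesis
      using complexity[OF exI, OF small] order_trans ereal_less_eq(3) unfolding Q_def by blast
  qed
qed

end

theorem theorem3:
  fixes A :: "real^'n^'m" and b \<xi> :: "real^'m" and xs :: "real^'n"
    and I1 I2 :: "'m set" and t \<sigma> :: real
  assumes "I1 \<inter> I2 = {}" and "I1 \<union> I2 = UNIV"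
    and "\<forall>i\<in>I1. b $ i = (A $ i \<bullet> xs)\<^sup>2"
    and "\<forall>i\<in>I2. b $ i = \<xi> $ i"
    and "t = 1 / lip_const A"
    and "\<sigma> > 0"
    and "\<forall>x. loss A b x - loss A b xs \<ge> \<sigma> * signal_dist xs x"
  shows
    "(\<forall>\<rho>>0. \<exists>E1>0. \<exists>E2>0. \<forall>\<tau> x la lb lc.
        (\<forall>k j. \<tau> k j = 1 / (t * (spectral_norm (sub_matrix A (x k)))\<^sup>2)) \<longrightarrow>
        ipl_fista_run A b t \<tau> (lacc \<rho>) x la lb lc \<longrightarrow>
        signal_dist xs (x 0) \<le> E1 \<longrightarrow>
        (\<forall>\<epsilon>>0. ereal_of_enat (overall_complexity A b xs t (lacc \<rho>) x la \<epsilon>) \<le> ereal (E2 / \<epsilon>)))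
     \<and>
     (\<forall>\<rho>. 0 < \<rho> \<and> \<rho> < 1/4 \<longrightarrow>
      (\<exists>E3>0. \<exists>E4>0. \<exists>\<epsilon> :: (nat \<Rightarrow> real) \<Rightarrow> nat \<Rightarrow> real. \<forall>\<tau> x la lb lc.
        (\<forall>k j. \<tau> k j = 1 / (t * (spectral_norm (sub_matrix A (x k)))\<^sup>2)) \<longrightarrow>
        ipl_fista_run A b t \<tau> (hacc \<rho>) x la lb lc \<longrightarrow>
        (let e = \<epsilon> (\<lambda>k. signal_dist xs (x k)) in
          (\<forall>i\<ge>1. 0 < e i) \<and> (\<forall>i\<ge>1. e (Suc i) < e i) \<and> e \<longlonglongrightarrow> 0 \<and>
          (signal_dist xs (x 0) \<le> E3 \<longrightarrow>
            (\<forall>i\<ge>1. ereal_of_enat (overall_complexity A b xs t (hacc \<rho>) x la (e i))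
                     \<le> ereal (E4 / e i))))))"
proof -
  interpret sharp_phase_retrieval A b xs \<sigma>
    using assms by unfold_locales auto
  have t: "t = 1 / L" using assms(5) by (simp add: L_def)
  have G: "M + L > 0" using M_pos L_pos by simp
  show ?thesis (is "(\<forall>\<rho>>0. ?low \<rho>) \<and> (\<forall>\<rho>. 0 < \<rho> \<and> \<rho> < 1/4 \<longrightarrow> ?high \<rho>)")
  proof (intro conjI allI impI)
    fix \<rho> :: real assume \<rho>: "\<rho> > 0"
    have W: "WL \<rho> > 0" using C_nonneg \<rho> \<sigma>_pos by (simp add: WL_def add_nonneg_pos)
    let ?E1 = "min r (\<sigma> * r / (M + L))" and ?E2 = "2 * WL \<rho> * (M + L) * (1 + \<rho>) / \<sigma>"
    have E: "0 < ?E1" "0 < ?E2" using W G \<rho> r_pos \<sigma>_pos by simp_all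
    have run: "ereal_of_enat (overall_complexity A b xs (1 / L) (lacc \<rho>) x la \<epsilon>) \<le> ereal (?E2 / \<epsilon>)"
      if "\<forall>k j. \<tau> k j = 1 / (1 / L * (spectral_norm (sub_matrix A (x k)))\<^sup>2)"
        "ipl_fista_run A b (1 / L) \<tau> (lacc \<rho>) x la lb lc" "signal_dist xs (x 0) \<le> ?E1" "\<epsilon> > 0"
      for \<tau> x la lb lc \<epsilon>
      using lacc_complexity[OF \<rho> that(1)[rule_format] that(2-4)] .
    show "?low \<rho>"
      by (rule exI[of _ ?E1], rule conjI[OF E(1)], rule exI[of _ ?E2], rule conjI[OF E(2)],
          intro allI impI, rule run[folded t])
  next
    fix \<rho> :: real assume "0 < \<rho> \<and> \<rho> < 1 / 4"
    then have \<rho>: "0 < \<rho>" "\<rho> < 1 / 4" by auto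
    have W: "WH \<rho> \<ge> 0" using C_nonneg \<rho> \<sigma>_pos L_pos by (simp add: WH_def)
    let ?E3 = "min r (\<sigma> / (10 * L))" and ?E4 = "max 1 (WH \<rho> * (4 / 3) * (5 * L / \<sigma>))"
    have E: "0 < ?E3" "0 < ?E4" using r_pos \<sigma>_pos L_pos by simp_all
    have run: "ereal_of_enat (overall_complexity A b xs (1 / L) (hacc \<rho>) x la
          (acc_seq (WH \<rho>) (\<lambda>k. signal_dist xs (x k)) i))
        \<le> ereal (?E4 / acc_seq (WH \<rho>) (\<lambda>k. signal_dist xs (x k)) i)"
      if "\<forall>k j. \<tau> k j = 1 / (1 / L * (spectral_norm (sub_matrix A (x k)))\<^sup>2)"
        "ipl_fista_run A b (1 / L) \<tau> (hacc \<rho>) x la lb lc" "signal_dist xs (x 0) \<le> ?E3" "i \<ge> 1"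
      for \<tau> x la lb lc i
      using hacc_complexity[OF \<rho> that(1)[rule_format] that(2-4)] .
    show "?high \<rho>"
      unfolding Let_def
      \<comment> \<open>\<open>acc_seq (WH \<rho>)\<close> is fixed before the run, and its
        properties hold for any distance sequence.\<close>
      by (rule exI[of _ ?E3], rule conjI[OF E(1)], rule exI[of _ ?E4], rule conjI[OF E(2)],
          rule exI[of _ "acc_seq (WH \<rho>)"], intro conjI allI impI acc_seq_props[OF W],
          rule run[folded t])
  qed
qed

end
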